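(* Let $A,B$ be normal $n\times n$ complex matrices and let $f:[0,\infty)\to[0,\infty)$ be concave. Then for every symmetric norm $\|\cdot\|$ on $n\times n$ matrices, $$\|\, f(|A+B|)\,\| \le \|\, f(|A|)+f(|B|)\,\|.$$
   Context: For a matrix $X$, $|X|=(X^*X)^{1/2}$, and $f(|X|)$ is defined by the functional calculus for the positive semi-definite matrix $|X|$. A symmetric (unitarily invariant) norm is a norm on $n\times n$ matrices satisfying $\|UXV\|=\|X\|$ for all matrices $X$ and all unitaries $U,V$. *)

theory Defs
  imports "HOL-Analysis.Analysis"
begin

type_synonym 'n cmat = "complex ^ 'n ^ 'n"

definition adj :: "'n::finite cmat \<Rightarrow> 'n cmat" where
  "adj A = (\<chi> i j. cnj (A $ j $ i))"

definition unitary :: "'n::finite cmat \<Rightarrow> bool" where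
  "unitary U \<longleftrightarrow> U ** adj U = mat 1 \<and> adj U ** U = mat 1"

definition normal_mat :: "'n::finite cmat \<Rightarrow> bool" where
  "normal_mat A \<longleftrightarrow> A ** adj A = adj A ** A"

definition diag_mat :: "('n::finite \<Rightarrow> complex) \<Rightarrow> 'n cmat" where
  "diag_mat d = (\<chi> i j. if i = j then d i else 0)"

definition smat :: "complex \<Rightarrow> 'n::finite cmat \<Rightarrow> 'n cmat" where
  "smat c A = (\<chi> i j. c * A $ i $ j)"

definition psd :: "'n::finite cmat \<Rightarrow> bool" where
  "psd H \<longleftrightarrow> adj H = H \<and>
     (\<forall>x::complex^'n. 0 \<le> Re (\<Sum>i\<in>UNIV. \<Sum>j\<in>UNIV. cnj (x $ i) * H $ i $ j * x $ j))"

definition mat_abs :: "'n::finite cmat \<Rightarrow> 'n cmat" where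
  "mat_abs X = (THE P. psd P \<and> P ** P = adj X ** X)"

definition mat_fun :: "(real \<Rightarrow> real) \<Rightarrow> 'n::finite cmat \<Rightarrow> 'n cmat" where
  "mat_fun f H = (SOME M. \<exists>U d. unitary U \<and> (\<forall>i. 0 \<le> d i) \<and>
       H = U ** diag_mat (\<lambda>i. complex_of_real (d i)) ** adj U \<and>
       M = U ** diag_mat (\<lambda>i. complex_of_real (f (d i))) ** adj U)"

definition symmetric_norm :: "('n::finite cmat \<Rightarrow> real) \<Rightarrow> bool" where
  "symmetric_norm N \<longleftrightarrow>
     (\<forall>X. 0 \<le> N X) \<and> (\<forall>X. N X = 0 \<longleftrightarrow> X = 0) \<and>
     (\<forall>c X. N (smat c X) = cmod c * N X) \<and>
     (\<forall>X Y. N (X + Y) \<le> N X + N Y) \<and>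
     (\<forall>U V X. unitary U \<and> unitary V \<longrightarrow> N (U ** X ** V) = N X)"

end

theory Submission
  imports Defs
begin

text \<open>Let \<open>S = A + B\<close>. By Ky Fan dominance it suffices to bound sums of the largest eigenvalues of
  \<open>f(|S|)\<close>, and subtracting a constant we may take \<open>f(0) = 0\<close>. Singular vectors \<open>u\<^sub>j, w\<^sub>j\<close> of the normal
  matrix \<open>A\<close> give unit vectors \<open>z\<^sub>j = (u\<^sub>j, w\<^sub>j) / \<surd>2\<close> in the doubled space, namely eigenvectors of the
  positive part of the Hermitian matrix with off-diagonal blocks \<open>A\<close> and \<open>A\<^sup>*\<close>; similarly for \<open>B\<close>. If
  \<open>T\<close> is the sum of these two positive parts, the singular values of \<open>S\<close> are dominated one by one by
  eigenvalues of \<open>T\<close>. For a sum \<open>T = \<Sum> a\<^sub>r z\<^sub>r z\<^sub>r\<^sup>*\<close> over unit vectors and concave \<open>f\<close>, the Ky Fan sums of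
  \<open>f(T)\<close> are at most those of \<open>\<Sum> f(a\<^sub>r) z\<^sub>r z\<^sub>r\<^sup>*\<close>. Finally, the Gram matrix of the vectors
  \<open>\<surd>f(a\<^sub>r) z\<^sub>r\<close> is the mean of the Gram matrices of the \<open>\<surd>f(a\<^sub>r) u\<^sub>r\<close> and of the \<open>\<surd>f(a\<^sub>r) w\<^sub>r\<close>, each of
  which has the nonzero eigenvalues of \<open>f(|A|) + f(|B|)\<close>, since for normal matrices both families of
  singular vectors diagonalise the absolute value.\<close>

section \<open>The complex inner product on column vectors, conjugate-linear in its first
  argument\<close>

definition cip :: "complex^'n::finite \<Rightarrow> complex^'n \<Rightarrow> complex" where
  "cip x y = (\<Sum>i\<in>UNIV. cnj (x $ i) * y $ i)"

lemma cip_add_right: "cip x (y + z) = cip x y + cip x z"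
  by (simp add: cip_def algebra_simps sum.distrib)

lemma cip_add_left: "cip (x + y) z = cip x z + cip y z"
  by (simp add: cip_def algebra_simps sum.distrib)

lemma cip_diff_right: "cip x (y - z) = cip x y - cip x z"
  by (simp add: cip_def algebra_simps sum_subtractf)

lemma cip_diff_left: "cip (x - y) z = cip x z - cip y z"
  by (simp add: cip_def algebra_simps sum_subtractf)

lemma cip_scale_right: "cip x (c *s y) = c * cip x y"
  by (simp add: cip_def sum_distrib_left algebra_simps)

lemma cip_scale_left: "cip (c *s x) y = cnj c * cip x y"
  by (simp add: cip_def sum_distrib_left algebra_simps)

lemma cip_zero_right [simp]: "cip x 0 = 0"
  by (simp add: cip_def)

lemma cip_zero_left [simp]: "cip 0 x = 0"
  by (simp add: cip_def)

lemma cip_sum_right: "cip x (\<Sum>i\<in>K. f i) = (\<Sum>i\<in>K. cip x (f i))"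
  by (induction K rule: infinite_finite_induct) (auto simp: cip_add_right)

lemma cip_sum_left: "cip (\<Sum>i\<in>K. f i) x = (\<Sum>i\<in>K. cip (f i) x)"
  by (induction K rule: infinite_finite_induct) (auto simp: cip_add_left)

lemma cnj_cip: "cnj (cip x y) = cip y x"
  by (simp add: cip_def mult.commute)

lemma norm_cip_commute: "cmod (cip x y) = cmod (cip y x)"
  by (metis cnj_cip complex_mod_cnj)

lemma of_real_cmod_square: "(complex_of_real (cmod z))\<^sup>2 = z * cnj z"
  by (metis complex_norm_square of_real_power)

lemma cip_self: "cip x x = of_real ((norm x)\<^sup>2)"
proof -
  have "(norm x)\<^sup>2 = (\<Sum>i\<in>UNIV. (cmod (x $ i))\<^sup>2)"
    by (simp add: norm_vec_def L2_set_def sum_nonneg)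
  then show ?thesis
    unfolding cip_def by (simp add: of_real_cmod_square mult.commute)
qed

lemmas cip_simps = cip_add_right cip_add_left cip_diff_right cip_diff_left
  cip_scale_right cip_scale_left

lemma norm_scale: "norm (c *s (x::complex^'n::finite)) = cmod c * norm x"
proof -
  have "complex_of_real ((norm (c *s x))\<^sup>2) = cnj c * (c * cip x x)"
    by (simp add: cip_self[symmetric] cip_simps del: of_real_power)
  also have "\<dots> = of_real ((cmod c * norm x)\<^sup>2)"
    by (simp add: cip_self power_mult_distrib of_real_cmod_square mult_ac)
  finally have "complex_of_real ((norm (c *s x))\<^sup>2) = of_real ((cmod c * norm x)\<^sup>2)" .
  then have "(norm (c *s x))\<^sup>2 = (cmod c * norm x)\<^sup>2"
    using of_real_eq_iff by blast
  then show ?thesis by (simp add: power2_eq_iff_nonneg)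
qed

subsection \<open>Adjoints of rectangular matrices\<close>

text \<open>\<open>adj\<close> is typed for square matrices only; the matrices of column vectors
  used later map between spaces of different dimension.\<close>

definition hadj :: "complex^'r::finite^'m::finite \<Rightarrow> complex^'m^'r" where
  "hadj Z = (\<chi> i j. cnj (Z $ j $ i))"

lemma hadj_hadj [simp]: "hadj (hadj Z) = Z"
  by (simp add: hadj_def vec_eq_iff)

lemma hadj_eq_adj: "hadj A = adj A"
  by (simp add: hadj_def adj_def)

lemma adj_adj [simp]: "adj (adj A) = A"
  by (simp add: adj_def vec_eq_iff)

lemma cip_hadj: "cip x (Z *v y) = cip (hadj Z *v x) y"
proof -
  have "cip x (Z *v y) = (\<Sum>i\<in>UNIV. \<Sum>j\<in>UNIV. cnj (x $ i) * Z $ i $ j * y $ j)"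
    by (simp add: cip_def matrix_vector_mult_def sum_distrib_left mult.assoc)
  also have "\<dots> = (\<Sum>j\<in>UNIV. \<Sum>i\<in>UNIV. cnj (x $ i) * Z $ i $ j * y $ j)"
    by (rule sum.swap)
  also have "\<dots> = cip (hadj Z *v x) y"
    by (simp add: cip_def matrix_vector_mult_def hadj_def sum_distrib_right sum_distrib_left
        mult_ac)
  finally show ?thesis .
qed

lemma cip_adj: "cip x (A *v y) = cip (adj A *v x) y"
  by (simp add: cip_hadj hadj_eq_adj)

lemma hadj_mult: "hadj (A ** B) = hadj B ** hadj A"
  by (simp add: hadj_def matrix_matrix_mult_def vec_eq_iff mult.commute)

lemma adj_mult: "adj (A ** B) = adj B ** adj A"
  by (metis hadj_eq_adj hadj_mult)

lemma psd_iff: "psd H \<longleftrightarrow> adj H = H \<and> (\<forall>x. 0 \<le> Re (cip x (H *v x)))"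
  by (simp add: psd_def cip_def matrix_vector_mult_def sum_distrib_left mult.assoc)

lemma norm_hadj_mult: "(norm (hadj Z *v x))\<^sup>2 = Re (cip x ((Z ** hadj Z) *v x))"
  by (simp add: matrix_vector_mul_assoc[symmetric] cip_hadj cip_self flip: of_real_power)

subsection \<open>Orthonormal families\<close>

text \<open>Indexing by a set lets one predicate cover bases (\<open>K = UNIV\<close>), partial
  families, and bare sets of vectors (\<open>t\<close> the identity).\<close>

definition onf :: "'i set \<Rightarrow> ('i \<Rightarrow> complex^'n::finite) \<Rightarrow> bool" where
  "onf K t \<longleftrightarrow> (\<forall>i\<in>K. \<forall>j\<in>K. cip (t i) (t j) = (if i = j then 1 else 0))"

lemma onfD: "onf K t \<Longrightarrow> i \<in> K \<Longrightarrow> j \<in> K \<Longrightarrow> cip (t i) (t j) = (if i = j then 1 else 0)"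
  by (simp add: onf_def)

lemma onf_subset: "onf K t \<Longrightarrow> L \<subseteq> K \<Longrightarrow> onf L t"
  unfolding onf_def by blast

lemma onf_norm: "onf K t \<Longrightarrow> i \<in> K \<Longrightarrow> norm (t i) = 1"
proof -
  assume "onf K t" "i \<in> K"
  then have "complex_of_real ((norm (t i))\<^sup>2) = of_real 1"
    by (simp add: onf_def cip_self[symmetric] del: of_real_power)
  then have "(norm (t i))\<^sup>2 = 1" using of_real_eq_iff by blast
  then show ?thesis by (metis norm_ge_zero power2_eq_1_iff neg_0_le_iff_le not_one_le_zero)
qed

lemma onf_inj: "onf K t \<Longrightarrow> inj_on t K"
  by (rule inj_onI) (metis onfD zero_neq_one)

lemma onf_image: "onf K t \<Longrightarrow> onf (t ` K) (\<lambda>x. x)"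
  by (auto simp: onf_def) (metis zero_neq_one)

lemma cip_onf_sum:
  assumes "onf K t" "finite K" "i \<in> K"
  shows "cip (t i) (\<Sum>j\<in>K. c j *s t j) = c i"
proof -
  have "cip (t i) (\<Sum>j\<in>K. c j *s t j) = (\<Sum>j\<in>K. c j * (if j = i then 1 else 0))"
    unfolding cip_sum_right cip_scale_right
    using assms by (intro sum.cong refl) (simp add: onfD)
  also have "\<dots> = (\<Sum>j\<in>K. if j = i then c j else 0)"
    by (intro sum.cong) auto
  finally show ?thesis using assms by simp
qed

lemma norm_onf_sum:
  assumes "onf K t" "finite K"
  shows "(norm (\<Sum>j\<in>K. c j *s t j))\<^sup>2 = (\<Sum>j\<in>K. (cmod (c j))\<^sup>2)"
proof -
  have "complex_of_real ((norm (\<Sum>j\<in>K. c j *s t j))\<^sup>2)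
      = (\<Sum>i\<in>K. cnj (c i) * cip (t i) (\<Sum>j\<in>K. c j *s t j))"
    by (subst cip_self[symmetric]) (simp add: cip_sum_left cip_scale_left)
  also have "\<dots> = (\<Sum>i\<in>K. cnj (c i) * c i)"
    by (intro sum.cong refl) (simp add: cip_onf_sum assms)
  also have "\<dots> = of_real (\<Sum>j\<in>K. (cmod (c j))\<^sup>2)"
    by (simp add: of_real_cmod_square mult.commute)
  finally show ?thesis using of_real_eq_iff by blast
qed

text \<open>Pythagoras for the projection onto the span of the family; Bessel's inequality and
  Parseval's identity are both read off from it.\<close>

lemma bessel_diff:
  assumes "onf K t" "finite K"
  shows "(norm (x - (\<Sum>i\<in>K. cip (t i) x *s t i)))\<^sup>2
     = (norm x)\<^sup>2 - (\<Sum>i\<in>K. (cmod (cip (t i) x))\<^sup>2)"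
proof -
  define y where "y = (\<Sum>i\<in>K. cip (t i) x *s t i)"
  have yx: "cip y x = of_real (\<Sum>i\<in>K. (cmod (cip (t i) x))\<^sup>2)"
    by (simp add: y_def cip_sum_left cip_scale_left of_real_cmod_square mult.commute)
  have yy: "cip y y = of_real (\<Sum>i\<in>K. (cmod (cip (t i) x))\<^sup>2)"
    by (simp add: cip_self y_def norm_onf_sum[OF assms])
  have xy: "cip x y = of_real (\<Sum>i\<in>K. (cmod (cip (t i) x))\<^sup>2)"
    by (metis yx cnj_cip complex_cnj_complex_of_real)
  have "complex_of_real ((norm (x - y))\<^sup>2)
      = of_real ((norm x)\<^sup>2 - (\<Sum>i\<in>K. (cmod (cip (t i) x))\<^sup>2))"
    by (subst cip_self[symmetric]) (simp add: cip_diff_left cip_diff_right yx yy xy, simp add: cip_self)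
  then show ?thesis unfolding y_def using of_real_eq_iff by blast
qed

lemma bessel:
  assumes "onf K t" "finite K"
  shows "(\<Sum>i\<in>K. (cmod (cip (t i) x))\<^sup>2) \<le> (norm x)\<^sup>2"
  using bessel_diff[OF assms, of x] zero_le_power2[of "norm (x - (\<Sum>i\<in>K. cip (t i) x *s t i))"]
  by linarith

text \<open>The index type of the family is that of the coordinates, so the matrix with columns
  \<open>t i\<close> is square and its left inverse is also a right inverse.\<close>

lemma onf_expand:
  fixes t :: "'n::finite \<Rightarrow> complex^'n"
  assumes "onf UNIV t"
  shows "(\<Sum>i\<in>UNIV. cip (t i) x *s t i) = x"
proof -
  define U :: "complex^'n^'n" where "U = (\<chi> i j. t j $ i)"
  have "adj U ** U = mat 1"
    using assms by (simp add: U_def adj_def matrix_matrix_mult_def mat_def vec_eq_iff onf_def cip_def)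
  then have "U ** adj U = mat 1" by (simp add: matrix_left_right_inverse)
  then have "U *v (adj U *v x) = x"
    by (simp add: matrix_vector_mul_assoc)
  moreover have "U *v (adj U *v x) = (\<Sum>i\<in>UNIV. cip (t i) x *s t i)"
    by (simp add: U_def adj_def matrix_vector_mult_def vec_eq_iff cip_def mult.commute)
  ultimately show ?thesis by simp
qed

lemma parseval:
  fixes t :: "'n::finite \<Rightarrow> complex^'n"
  assumes "onf UNIV t"
  shows "(\<Sum>i\<in>UNIV. (cmod (cip (t i) x))\<^sup>2) = (norm x)\<^sup>2"
  using bessel_diff[OF assms, of x] onf_expand[OF assms, of x] by simp

subsection \<open>Sums of rank-one matrices\<close>

text \<open>For an orthonormal \<open>z\<close> this is a spectral decomposition; the vectors may
  also be arbitrary and their number unrelated to the dimension.\<close>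

definition rank1sum :: "('r::finite \<Rightarrow> real) \<Rightarrow> ('r \<Rightarrow> complex^'m::finite) \<Rightarrow> 'm cmat" where
  "rank1sum a z = (\<chi> i j. \<Sum>r\<in>UNIV. of_real (a r) * (z r $ i) * cnj (z r $ j))"

lemma rank1sum_mult: "rank1sum a z *v x = (\<Sum>r\<in>UNIV. (of_real (a r) * cip (z r) x) *s z r)"
proof -
  have "(rank1sum a z *v x) $ i = (\<Sum>r\<in>UNIV. (of_real (a r) * cip (z r) x) *s z r) $ i" for i
  proof -
    have "(rank1sum a z *v x) $ i
        = (\<Sum>j\<in>UNIV. \<Sum>r\<in>UNIV. of_real (a r) * (z r $ i) * cnj (z r $ j) * x $ j)"
      by (simp add: rank1sum_def matrix_vector_mult_def sum_distrib_right)
    also have "\<dots> = (\<Sum>r\<in>UNIV. \<Sum>j\<in>UNIV. of_real (a r) * (z r $ i) * cnj (z r $ j) * x $ j)"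
      by (rule sum.swap)
    finally show ?thesis
      by (simp add: cip_def sum_distrib_left sum_distrib_right mult_ac)
  qed
  then show ?thesis by (simp add: vec_eq_iff)
qed

lemma rank1sum_form:
  "Re (cip x (rank1sum a z *v x)) = (\<Sum>r\<in>UNIV. a r * (cmod (cip (z r) x))\<^sup>2)"
proof -
  have "cip x (rank1sum a z *v x) = (\<Sum>r\<in>UNIV. of_real (a r) * (cip (z r) x * cnj (cip (z r) x)))"
    by (simp add: rank1sum_mult cip_sum_right cip_scale_right cnj_cip mult.assoc)
  also have "\<dots> = of_real (\<Sum>r\<in>UNIV. a r * (cmod (cip (z r) x))\<^sup>2)"
    by (simp add: of_real_cmod_square)
  finally show ?thesis by simp
qed

lemma rank1sum_eigen:
  assumes "onf UNIV t"
  shows "rank1sum a t *v t i = of_real (a i) *s t i"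
proof -
  have "rank1sum a t *v t i = (\<Sum>r\<in>UNIV. if r = i then of_real (a i) *s t i else 0)"
    unfolding rank1sum_mult using assms by (intro sum.cong) (auto simp: onf_def)
  then show ?thesis by simp
qed

lemma adj_rank1sum: "adj (rank1sum a z) = rank1sum a z"
  by (simp add: adj_def rank1sum_def vec_eq_iff mult_ac)

lemma rank1sumI:
  fixes t :: "'n::finite \<Rightarrow> complex^'n"
  assumes "onf UNIV t" "\<And>i. H *v t i = of_real (a i) *s t i"
  shows "H = rank1sum a t"
proof -
  have "H *v x = rank1sum a t *v x" for x
  proof -
    have "H *v x = H *v (\<Sum>i\<in>UNIV. cip (t i) x *s t i)" by (simp add: onf_expand assms)
    also have "\<dots> = (\<Sum>i\<in>UNIV. cip (t i) x *s (H *v t i))"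
      by (simp add: vec.linear_sum[OF matrix_vector_mul_linear_gen] vector_scalar_commute)
    also have "\<dots> = rank1sum a t *v x"
      by (simp add: assms rank1sum_mult mult.commute)
    finally show ?thesis .
  qed
  then show ?thesis by (simp add: matrix_eq)
qed

lemma psd_rank1sum: "(\<And>r. 0 \<le> a r) \<Longrightarrow> psd (rank1sum a z)"
  by (auto simp: psd_iff adj_rank1sum rank1sum_form intro!: sum_nonneg)

lemma mult_adj_eq_rank1sum: "Z ** hadj Z = rank1sum (\<lambda>_. 1) (\<lambda>r. column r Z)"
  by (simp add: matrix_matrix_mult_def hadj_def rank1sum_def column_def vec_eq_iff)

subsection \<open>The spectral theorem\<close>

lemma ortho_complement_nontrivial:
  fixes X :: "(complex^'n::finite) set"
  assumes "onf X (\<lambda>x. x)" "finite X" "card X < CARD('n)"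
  shows "\<exists>x. x \<noteq> 0 \<and> (\<forall>y\<in>X. cip y x = 0)"
proof (rule ccontr)
  assume neg: "\<not> ?thesis"
  have "x \<in> vec.span X" for x
  proof -
    define y where "y = (\<Sum>z\<in>X. cip z x *s z)"
    have "cip z (x - y) = 0" if "z \<in> X" for z
      using cip_onf_sum[OF assms(1,2) that, of "\<lambda>z. cip z x"]
      by (simp add: cip_diff_right y_def)
    then have "x = y" using neg by (metis eq_iff_diff_eq_0)
    moreover have "y \<in> vec.span X"
      unfolding y_def by (intro vec.span_sum vec.span_scale vec.span_base)
    ultimately show ?thesis by simp
  qed
  then have "vec.span X = UNIV" by auto
  then have "vec.dim (UNIV :: (complex^'n) set) \<le> card X"
    using assms(2) by (intro vec.dim_le_card) auto
  then show False using assms(3) by (simp add: vec.dim_UNIV card_cart_basis)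
qed

text \<open>The orthogonal complement of a set of eigenvectors is invariant under \<open>H\<close>.
  A maximiser of the quadratic form on its unit sphere is an eigenvector, by the vanishing of the
  first variation.\<close>

lemma eigenvector_in_complement:
  fixes H :: "'n::finite cmat"
  assumes H: "adj H = H"
    and X: "\<And>y. y \<in> X \<Longrightarrow> \<exists>l. H *v y = l *s y"
    and ex: "x1 \<noteq> 0" "\<forall>y\<in>X. cip y x1 = 0"
  shows "\<exists>x (l::real). norm x = 1 \<and> (\<forall>y\<in>X. cip y x = 0) \<and> H *v x = of_real l *s x"
proof -
  define W where "W = {x. \<forall>y\<in>X. cip y x = 0}"
  define q where "q = (\<lambda>x. Re (cip x (H *v x)))"
  have cont_cip: "continuous_on UNIV (\<lambda>x. cip (f x) (g x))"
    if "continuous_on UNIV f" "continuous_on UNIV g" for f g :: "complex^'n \<Rightarrow> complex^'n"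
    unfolding cip_def using that by (intro continuous_intros) auto
  have contH: "continuous_on UNIV (\<lambda>x. H *v x)"
    unfolding matrix_vector_mult_def by (intro continuous_intros)
  have contq: "continuous_on UNIV q"
    unfolding q_def by (intro continuous_on_Re cont_cip contH continuous_on_id)
  have "W = (\<Inter>y\<in>X. {x. cip y x = 0})" by (auto simp: W_def)
  moreover have "closed {x. cip y x = 0}" for y :: "complex^'n"
    using continuous_closed_preimage_constant[OF cont_cip[of "\<lambda>_. y" "\<lambda>x. x"] closed_UNIV, of 0]
    by simp
  ultimately have "closed W" by auto
  then have comp: "compact (sphere 0 1 \<inter> W)"
    by (intro compact_Int_closed) auto
  have Wsc: "c *s x \<in> W" if "x \<in> W" for c x
    using that by (simp add: W_def cip_scale_right)
  have Wadd: "x + y \<in> W" if "x \<in> W" "y \<in> W" for x y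
    using that by (simp add: W_def cip_add_right)
  have WH: "H *v x \<in> W" if "x \<in> W" for x
    unfolding W_def
  proof safe
    fix y assume "y \<in> X"
    then obtain l where "H *v y = l *s y" using X by blast
    then have "cip y (H *v x) = cnj l * cip y x"
      by (simp add: cip_adj H cip_scale_left)
    then show "cip y (H *v x) = 0" using that \<open>y \<in> X\<close> by (simp add: W_def)
  qed
  have "of_real (1 / norm x1) *s x1 \<in> sphere 0 1 \<inter> W"
    using ex Wsc[of x1] by (simp add: W_def norm_scale norm_divide)
  then have "sphere 0 1 \<inter> W \<noteq> {}" by blast
  then obtain x where x: "x \<in> sphere 0 1 \<inter> W"
    and max: "\<And>y. y \<in> sphere 0 1 \<inter> W \<Longrightarrow> q y \<le> q x"
    using continuous_attains_sup[OF comp _ continuous_on_subset[OF contq]] by blast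
  define l where "l = q x"
  \<comment> \<open>The quadratic form of \<open>l - H\<close>: nonnegative on \<open>W\<close> by
    maximality of \<open>l\<close>, and zero at \<open>x\<close>.\<close>
  define b where "b = (\<lambda>y. l * (norm y)\<^sup>2 - q y)"
  have qsc: "q (c *s y) = (cmod c)\<^sup>2 * q y" for c y
  proof -
    have "cip (c *s y) (H *v (c *s y)) = of_real ((cmod c)\<^sup>2) * cip y (H *v y)"
      by (simp add: vector_scalar_commute cip_simps of_real_cmod_square mult_ac)
    then show ?thesis by (simp add: q_def)
  qed
  have bpos: "0 \<le> b y" if "y \<in> W" for y
  proof (cases "y = 0")
    case False
    have "q (of_real (1 / norm y) *s y) \<le> q x"
      using False that Wsc[of y] by (intro max) (auto simp: norm_scale norm_divide)
    then have "q y / (norm y)\<^sup>2 \<le> l"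
      by (simp add: qsc norm_divide power_divide l_def)
    then show ?thesis using False by (simp add: b_def field_simps)
  qed (simp add: b_def q_def)
  define r where "r = of_real l *s x - H *v x"
  have rW: "r \<in> W"
    using Wadd[OF Wsc[of x "of_real l"] Wsc[OF WH[of x], of "-1"]] x
    by (simp add: r_def)
  have b_expand: "b (x + of_real s *s r) = b x + 2 * s * (norm r)\<^sup>2 + s\<^sup>2 * b r" for s
  proof -
    have b_alt: "b y = Re (cip y (of_real l *s y - H *v y))" for y
      by (simp add: b_def q_def cip_simps cip_self flip: of_real_power)
    define B where "B = (\<lambda>y. complex_of_real l *s y - H *v y)"
    have Bself: "cip y (B z) = cip (B y) z" for y z
      by (simp add: B_def cip_simps) (simp add: cip_adj H)
    have Badd: "B (x + of_real s *s r) = B x + of_real s *s B r"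
      by (simp add: B_def matrix_vector_right_distrib vector_scalar_commute
          vec_eq_iff algebra_simps)
    have Bx: "B x = r" by (simp add: B_def r_def)
    have "cip (x + of_real s *s r) (B (x + of_real s *s r))
       = cip x (B x) + of_real s * cip r (B x) + of_real s * cip x (B r) + of_real (s\<^sup>2) * cip r (B r)"
      by (simp add: Badd cip_simps power2_eq_square algebra_simps)
    also have "cip x (B r) = cip r r" by (simp add: Bself Bx)
    also have "cip r (B x) = cip r r" by (simp add: Bx)
    finally have "Re (cip (x + of_real s *s r) (B (x + of_real s *s r)))
       = Re (cip x (B x)) + 2 * s * (norm r)\<^sup>2 + s\<^sup>2 * Re (cip r (B r))"
      by (simp add: cip_self flip: of_real_power)
    then show ?thesis by (simp add: b_alt B_def)
  qed
  have bx: "b x = 0" using x by (simp add: b_def l_def)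
  have "(norm r)\<^sup>2 = 0"
  proof (rule ccontr)
    assume "(norm r)\<^sup>2 \<noteq> 0"
    define \<rho> where "\<rho> = (norm r)\<^sup>2"
    have \<rho>: "\<rho> > 0" using \<open>(norm r)\<^sup>2 \<noteq> 0\<close> by (simp add: \<rho>_def)
    \<comment> \<open>A step of length \<open>e\<close> from \<open>x\<close> against the residual
      \<open>r\<close> changes the form by \<open>-2 * e * \<rho> + e\<^sup>2 * b r\<close>. This
      \<open>e\<close> keeps the quadratic term below the linear one; the summand 1 covers the case
      \<open>b r = 0\<close>.\<close>
    define e where "e = \<rho> / (b r + 1)"
    have e: "e > 0" "e * b r \<le> \<rho>"
      using \<rho> bpos[OF rW] by (auto simp: e_def field_simps)
    have "0 \<le> b (x + of_real (-e) *s r)"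
      using x by (intro bpos Wadd Wsc rW) auto
    then have "0 \<le> - 2 * e * \<rho> + e\<^sup>2 * b r"
      by (simp only: b_expand bx \<rho>_def[symmetric]) simp
    also have "\<dots> = e * (e * b r - 2 * \<rho>)" by (simp add: power2_eq_square algebra_simps)
    finally have "0 \<le> e * b r - 2 * \<rho>" using e(1) by (simp add: zero_le_mult_iff)
    then show False using e \<rho> by linarith
  qed
  then have "H *v x = of_real l *s x" by (simp add: r_def)
  then show ?thesis using x by (auto simp: W_def)
qed

text \<open>Orthonormal sets of eigenvectors are enlarged one vector at a time; a set of full size
  is then indexed by \<open>'n\<close>.\<close>

theorem hermitian_spectral:
  fixes H :: "'n::finite cmat"
  assumes H: "adj H = H"
  obtains t :: "'n \<Rightarrow> complex^'n" and a :: "'n \<Rightarrow> real"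
  where "onf UNIV t" "H = rank1sum a t"
proof -
  have "k \<le> CARD('n) \<Longrightarrow> \<exists>X. finite X \<and> card X = k \<and> onf X (\<lambda>x. x) \<and>
      (\<forall>y\<in>X. \<exists>l::real. H *v y = of_real l *s y)" for k
  proof (induction k)
    case 0
    then show ?case by (intro exI[of _ "{}"]) (auto simp: onf_def)
  next
    case (Suc k)
    then obtain X where X: "finite X" "card X = k" "onf X (\<lambda>x. x)"
      "\<forall>y\<in>X. \<exists>l::real. H *v y = of_real l *s y" by auto
    obtain x1 where "x1 \<noteq> 0" "\<forall>y\<in>X. cip y x1 = 0"
      using ortho_complement_nontrivial[OF X(3,1)] X(2) Suc.prems by auto
    then obtain x and l::real where x: "norm x = 1" "\<forall>y\<in>X. cip y x = 0" "H *v x = of_real l *s x"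
      using eigenvector_in_complement[OF H, of X x1] X(4) by blast
    have xx: "cip x x = 1" using x(1) by (simp add: cip_self)
    have "x \<notin> X" using x(2) xx by force
    moreover have "\<forall>y\<in>X. cip x y = 0" using x(2) by (metis cnj_cip complex_cnj_zero)
    ultimately show ?case
      using X x xx by (intro exI[of _ "insert x X"]) (auto simp: onf_def)
  qed
  from this[of "CARD('n)"] obtain X where X: "finite X" "card X = CARD('n)" "onf X (\<lambda>x. x)"
      "\<forall>y\<in>X. \<exists>l::real. H *v y = of_real l *s y" by auto
  obtain t where t: "bij_betw t (UNIV::'n set) X"
    using finite_same_card_bij[of "UNIV::'n set" X] X by auto
  have tX: "t i \<in> X" for i using t by (auto simp: bij_betw_def)
  have on: "onf UNIV t"
    using X(3) tX t by (auto simp: onf_def bij_betw_def inj_eq)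
  have "\<forall>i. \<exists>l::real. H *v t i = of_real l *s t i" using X(4) tX by blast
  then obtain a where "\<forall>i. H *v t i = of_real (a i) *s t i" by metis
  then show ?thesis using on rank1sumI that by blast
qed

subsection \<open>Functional calculus and absolute value\<close>

lemma unitary_diag_rank1sum:
  "U ** diag_mat (\<lambda>i. complex_of_real (d i)) ** adj U = rank1sum d (\<lambda>i. column i U)"
proof -
  have "(\<Sum>k\<in>UNIV. U $ i $ k * (if k = r then complex_of_real (d k) else 0)) = U $ i $ r * of_real (d r)"
    for i r
  proof -
    have "(\<Sum>k\<in>UNIV. U $ i $ k * (if k = r then complex_of_real (d k) else 0))
       = (\<Sum>k\<in>UNIV. if k = r then U $ i $ k * of_real (d k) else 0)"
      by (intro sum.cong) auto
    then show ?thesis by simp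
  qed
  then show ?thesis
    by (simp add: diag_mat_def adj_def matrix_matrix_mult_def rank1sum_def column_def vec_eq_iff mult_ac)
qed

lemma onf_columns: "unitary U \<Longrightarrow> onf UNIV (\<lambda>i. column i U)"
  by (simp add: unitary_def adj_def matrix_matrix_mult_def mat_def vec_eq_iff onf_def cip_def column_def)

lemma unitary_of_onf:
  fixes t :: "'n::finite \<Rightarrow> complex^'n"
  assumes "onf UNIV t"
  obtains U where "unitary U" "\<And>i. column i U = t i"
proof -
  define U :: "complex^'n^'n" where "U = (\<chi> i j. t j $ i)"
  have "adj U ** U = mat 1"
    using assms by (simp add: U_def adj_def matrix_matrix_mult_def mat_def vec_eq_iff onf_def cip_def)
  then have "unitary U" by (simp add: unitary_def matrix_left_right_inverse)
  moreover have "column i U = t i" for i by (simp add: U_def column_def vec_eq_iff)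
  ultimately show ?thesis using that by blast
qed

text \<open>An overlap \<open>cip (t i) (u j)\<close> can be nonzero only if
  \<open>d i = e j\<close>, so \<open>f (d i)\<close> and \<open>f (e j)\<close> agree wherever they
  matter. This makes the choices in \<open>mat_fun\<close> and \<open>mat_abs\<close> well
  defined.\<close>

lemma rank1sum_calculus_unique:
  fixes t u :: "'n::finite \<Rightarrow> complex^'n"
  assumes t: "onf UNIV t" and u: "onf UNIV u" and eq: "rank1sum d t = rank1sum e u"
  shows "rank1sum (\<lambda>i. f (d i)) t = rank1sum (\<lambda>i. f (e i)) u"
proof (rule rank1sumI[OF u])
  fix j
  have "of_real (f (d i)) * cip (t i) (u j) = of_real (f (e j)) * cip (t i) (u j)" for i
  proof -
    have "of_real (d i) * cip (t i) (u j) = cip (rank1sum d t *v t i) (u j)"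
      by (simp add: rank1sum_eigen t cip_scale_left)
    also have "\<dots> = cip (t i) (rank1sum e u *v u j)"
      by (simp add: cip_adj adj_rank1sum eq)
    also have "\<dots> = of_real (e j) * cip (t i) (u j)"
      by (simp add: rank1sum_eigen u cip_scale_right)
    finally show ?thesis by auto
  qed
  then have "rank1sum (\<lambda>i. f (d i)) t *v u j
      = (\<Sum>i\<in>UNIV. (of_real (f (e j)) * cip (t i) (u j)) *s t i)"
    by (simp only: rank1sum_mult)
  also have "\<dots> = of_real (f (e j)) *s (\<Sum>i\<in>UNIV. cip (t i) (u j) *s t i)"
    by (simp add: vec.scale_sum_right)
  finally show "rank1sum (\<lambda>i. f (d i)) t *v u j = of_real (f (e j)) *s u j"
    by (simp add: onf_expand t)
qed

lemma mat_fun_rank1sum: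
  fixes t :: "'n::finite \<Rightarrow> complex^'n"
  assumes t: "onf UNIV t" and d: "\<And>i. 0 \<le> d i"
  shows "mat_fun f (rank1sum d t) = rank1sum (\<lambda>i. f (d i)) t"
proof -
  obtain U where U: "unitary U" "\<And>i. column i U = t i"
    using unitary_of_onf[OF t] by blast
  show ?thesis
    unfolding mat_fun_def
  proof (rule some_equality)
    show "\<exists>V e. unitary V \<and> (\<forall>i. 0 \<le> e i) \<and>
        rank1sum d t = V ** diag_mat (\<lambda>i. complex_of_real (e i)) ** adj V \<and>
        rank1sum (\<lambda>i. f (d i)) t = V ** diag_mat (\<lambda>i. complex_of_real (f (e i))) ** adj V"
      unfolding unitary_diag_rank1sum using U d by (intro exI[of _ U] exI[of _ d]) simp
  next
    fix M
    assume "\<exists>V e. unitary V \<and> (\<forall>i. 0 \<le> e i) \<and>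
        rank1sum d t = V ** diag_mat (\<lambda>i. complex_of_real (e i)) ** adj V \<and>
        M = V ** diag_mat (\<lambda>i. complex_of_real (f (e i))) ** adj V"
    then obtain V e where "unitary V" "rank1sum d t = rank1sum e (\<lambda>i. column i V)"
        "M = rank1sum (\<lambda>i. f (e i)) (\<lambda>i. column i V)"
      unfolding unitary_diag_rank1sum by blast
    then show "M = rank1sum (\<lambda>i. f (d i)) t"
      using rank1sum_calculus_unique[OF t onf_columns] by simp
  qed
qed

lemma rank1sum_square:
  fixes t :: "'n::finite \<Rightarrow> complex^'n"
  assumes "onf UNIV t"
  shows "rank1sum d t ** rank1sum d t = rank1sum (\<lambda>i. (d i)\<^sup>2) t"
  by (rule rank1sumI[OF assms])
     (simp add: matrix_vector_mul_assoc[symmetric] rank1sum_eigen assms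
       vector_scalar_commute power2_eq_square)

lemma psd_spectral:
  fixes H :: "'n::finite cmat"
  assumes "psd H"
  obtains t :: "'n \<Rightarrow> complex^'n" and a :: "'n \<Rightarrow> real"
  where "onf UNIV t" "H = rank1sum a t" "\<And>i. 0 \<le> a i"
proof -
  obtain t and a :: "'n \<Rightarrow> real" where t: "onf UNIV t" "H = rank1sum a t"
    using assms by (elim hermitian_spectral[of H, rotated]) (simp add: psd_iff)
  have "0 \<le> a i" for i
  proof -
    have "0 \<le> Re (cip (t i) (H *v t i))" using assms by (simp add: psd_iff)
    then show ?thesis using t(1) by (simp add: t(2) rank1sum_eigen cip_scale_right onfD)
  qed
  then show ?thesis using t that by blast
qed

text \<open>A positive square root is unique: applying \<open>sqrt\<close> to two spectral
  decompositions of the same square gives the same matrix.\<close>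

lemma mat_abs_eq:
  fixes t :: "'n::finite \<Rightarrow> complex^'n"
  assumes t: "onf UNIV t" and d: "\<And>i. 0 \<le> d i"
    and X: "adj X ** X = rank1sum (\<lambda>i. (d i)\<^sup>2) t"
  shows "mat_abs X = rank1sum d t"
  unfolding mat_abs_def
proof (rule the_equality)
  show "psd (rank1sum d t) \<and> rank1sum d t ** rank1sum d t = adj X ** X"
    by (simp add: psd_rank1sum d X rank1sum_square t)
next
  fix P assume P: "psd P \<and> P ** P = adj X ** X"
  then have "psd P" by simp
  then obtain u :: "'n \<Rightarrow> complex^'n" and p where u: "onf UNIV u" "P = rank1sum p u" "\<And>i. 0 \<le> p i"
    by (rule psd_spectral) (rule that)
  have "rank1sum (\<lambda>i. (p i)\<^sup>2) u = rank1sum (\<lambda>i. (d i)\<^sup>2) t"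
    using P u(2) X rank1sum_square[OF u(1)] by simp
  from rank1sum_calculus_unique[OF u(1) t this, of sqrt] show "P = rank1sum d t"
    by (simp add: u d)
qed

lemma mat_abs_spectral:
  fixes X :: "'n::finite cmat"
  obtains t :: "'n \<Rightarrow> complex^'n" and a :: "'n \<Rightarrow> real"
  where "onf UNIV t" "mat_abs X = rank1sum a t" "\<And>i. 0 \<le> a i"
    "adj X ** X = rank1sum (\<lambda>i. (a i)\<^sup>2) t"
proof -
  have "psd (adj X ** X)"
    by (simp add: psd_iff adj_mult matrix_vector_mul_assoc[symmetric] cip_adj[of _ "adj X"] cip_self
        flip: of_real_power)
  then obtain t :: "'n \<Rightarrow> complex^'n" and b where t: "onf UNIV t" "adj X ** X = rank1sum b t" "\<And>i. 0 \<le> b i"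
    by (rule psd_spectral) (rule that)
  define a where "a = (\<lambda>i. sqrt (b i))"
  have a: "\<And>i. 0 \<le> a i" "\<And>i. (a i)\<^sup>2 = b i" using t(3) by (auto simp: a_def)
  have "mat_abs X = rank1sum a t"
    by (rule mat_abs_eq) (simp_all add: t a)
  then show ?thesis using that[of t a] t a by simp
qed

section \<open>Singular vectors of normal matrices\<close>

lemma cip_image_image:
  assumes "onf UNIV t" "adj X ** X = rank1sum (\<lambda>i. (a i)\<^sup>2) t"
  shows "cip (X *v t i) (X *v t j) = (if i = j then of_real ((a i)\<^sup>2) else 0)"
proof -
  have "cip (X *v t i) (X *v t j) = cip (t i) ((adj X ** X) *v t j)"
    by (simp add: matrix_vector_mul_assoc[symmetric] cip_adj[of "t i" "adj X"])
  then show ?thesis using assms(1)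
    by (simp add: assms(2) rank1sum_eigen cip_scale_right onfD)
qed

text \<open>By normality the kernel of \<open>A\<close> is orthogonal to its range, so the normalised images of the
  eigenvectors of \<open>|A|\<close> are completed to an orthonormal basis by the eigenvectors in the kernel.\<close>

lemma normal_singular_vectors:
  fixes A :: "'n::finite cmat"
  assumes N: "normal_mat A"
  obtains u w :: "'n \<Rightarrow> complex^'n" and a :: "'n \<Rightarrow> real"
  where "onf UNIV u" "onf UNIV w" "\<And>i. 0 \<le> a i" "mat_abs A = rank1sum a w"
    "mat_abs A = rank1sum a u" "\<And>i. A *v w i = of_real (a i) *s u i"
proof -
  obtain w :: "'n \<Rightarrow> complex^'n" and a where w: "onf UNIV w" "mat_abs A = rank1sum a w" "\<And>i. 0 \<le> a i"
    "adj A ** A = rank1sum (\<lambda>i. (a i)\<^sup>2) w"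
    by (rule mat_abs_spectral[of A]) (rule that)
  define u where "u i = (if a i = 0 then w i else of_real (1 / a i) *s (A *v w i))" for i
  have ker: "A *v w i = 0 \<and> adj A *v w i = 0" if "a i = 0" for i
  proof -
    have "cip (A *v w i) (A *v w i) = 0" using that by (simp add: cip_image_image[OF w(1,4)])
    \<comment> \<open>Normality: \<open>A\<close> and its adjoint have equal norms on every vector,
      hence the same kernel.\<close>
    moreover have "cip (adj A *v w i) (adj A *v w i) = cip (A *v w i) (A *v w i)"
    proof -
      have "cip (adj A *v w i) (adj A *v w i) = cip (w i) ((A ** adj A) *v w i)"
        by (simp add: matrix_vector_mul_assoc[symmetric] cip_adj[of "w i" A])
      also have "\<dots> = cip (w i) ((adj A ** A) *v w i)" using N by (simp add: normal_mat_def)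
      finally show ?thesis by (simp add: matrix_vector_mul_assoc[symmetric] cip_adj[of "w i" "adj A"])
    qed
    ultimately show ?thesis by (simp add: cip_self)
  qed
  have Aw: "A *v w i = of_real (a i) *s u i" for i
    using ker by (simp add: u_def)
  have ort: "cip (w i) (A *v w j) = 0" if "a i = 0" for i j
    using ker[OF that] by (simp add: cip_adj)
  have ort': "cip (A *v w j) (w i) = 0" if "a i = 0" for i j
    by (metis ort[OF that] cnj_cip complex_cnj_zero)
  have u: "onf UNIV u"
    unfolding onf_def
  proof (intro ballI)
    fix i j
    show "cip (u i) (u j) = (if i = j then 1 else 0)"
      using onfD[OF w(1), of i j] ort[of i j] ort'[of j i]
      by (auto simp: u_def cip_scale_left cip_scale_right cip_image_image[OF w(1,4)]
          power2_eq_square)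
  qed
  \<comment> \<open>By normality \<open>A\<close> commutes with \<open>adj A ** A\<close> and maps
    its eigenspaces into themselves, so the images \<open>u i\<close> diagonalise \<open>|A|\<close>
    with the same eigenvalues.\<close>
  have "(adj A ** A) *v u i = of_real ((a i)\<^sup>2) *s u i" for i
  proof (cases "a i = 0")
    case True
    then show ?thesis by (simp add: u_def w(4) rank1sum_eigen[OF w(1)])
  next
    case False
    have "(adj A ** A) *v (A *v w i) = A *v ((adj A ** A) *v w i)"
      using N by (simp add: matrix_vector_mul_assoc matrix_mul_assoc normal_mat_def)
    also have "\<dots> = of_real ((a i)\<^sup>2) *s (A *v w i)"
      by (simp only: w(4) rank1sum_eigen[OF w(1)] vector_scalar_commute)
    finally show ?thesis using False
      by (simp add: u_def vector_scalar_commute vec.scale_scale mult.commute)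
  qed
  then have "mat_abs A = rank1sum a u"
    by (intro mat_abs_eq u w(3) rank1sumI)
  then show ?thesis using that[OF u w(1,3,2) _ Aw] by blast
qed

subsection \<open>Ky Fan sums\<close>

text \<open>\<open>L\<close> carries the \<open>card L\<close> largest values of \<open>a\<close>,
  with ties broken arbitrarily; this replaces sorting the eigenvalues.\<close>

definition top_set :: "('m \<Rightarrow> real) \<Rightarrow> 'm set \<Rightarrow> bool" where
  "top_set a L \<longleftrightarrow> (\<forall>i\<in>L. \<forall>j\<in>-L. a j \<le> a i)"

lemma ex_top_set:
  fixes a :: "'m::finite \<Rightarrow> real"
  assumes "k \<le> CARD('m)"
  shows "\<exists>L. card L = k \<and> top_set a L"
  using assms
proof (induction k)
  case 0
  then show ?case by (intro exI[of _ "{}"]) (simp add: top_set_def)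
next
  case (Suc k)
  then obtain L where L: "card L = k" "top_set a L" by auto
  have "L \<noteq> UNIV" using L Suc.prems by auto
  then have ne: "a ` (- L) \<noteq> {}" by auto
  then have "Max (a ` (-L)) \<in> a ` (-L)" by (intro Max_in) auto
  then obtain i where i: "i \<notin> L" "a i = Max (a ` (-L))" by auto
  have "a j \<le> a i" if "j \<notin> L" for j
    unfolding i(2) using that by (intro Max_ge) auto
  then show ?case using L i
    by (intro exI[of _ "insert i L"]) (auto simp: top_set_def)
qed

text \<open>A fractional selection of total weight at most \<open>card L\<close> cannot beat the
  best \<open>card L\<close> values: \<open>m\<close>, the least value on \<open>L\<close>, bounds
  from below what is missing on \<open>L\<close> and from above what is taken outside.\<close>

lemma top_set_sum_ge:
  fixes a c :: "'m::finite \<Rightarrow> real"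
  assumes L: "top_set a L" and a: "\<And>i. 0 \<le> a i" and c: "\<And>i. 0 \<le> c i" "\<And>i. c i \<le> 1"
    and s: "(\<Sum>i\<in>UNIV. c i) \<le> card L"
  shows "(\<Sum>i\<in>UNIV. a i * c i) \<le> (\<Sum>i\<in>L. a i)"
proof (cases "L = {}")
  case True
  then have "(\<Sum>i\<in>UNIV. c i) = 0" using s sum_nonneg[of UNIV c] c by force
  then have "c i = 0" for i using sum_nonneg_eq_0_iff[of UNIV c] c by auto
  then show ?thesis by (simp add: True)
next
  case False
  define m where "m = Min (a ` L)"
  have "m \<in> a ` L" unfolding m_def using False by (intro Min_in) auto
  then have m: "\<And>j. j \<notin> L \<Longrightarrow> a j \<le> m" "0 \<le> m" using L a by (auto simp: top_set_def)
  have mL: "\<And>i. i \<in> L \<Longrightarrow> m \<le> a i" unfolding m_def by simp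
  have split: "(\<Sum>i\<in>UNIV. g i) = (\<Sum>i\<in>L. g i) + (\<Sum>i\<in>-L. g i)" for g :: "'m \<Rightarrow> real"
    by (metis sum.subset_diff[of L UNIV g] finite subset_UNIV add.commute Compl_eq_Diff_UNIV)
  have "(\<Sum>i\<in>L. a i) - (\<Sum>i\<in>UNIV. a i * c i) = (\<Sum>i\<in>L. a i * (1 - c i)) - (\<Sum>i\<in>-L. a i * c i)"
    by (simp add: split algebra_simps sum_subtractf)
  also have "\<dots> \<ge> (\<Sum>i\<in>L. m * (1 - c i)) - (\<Sum>i\<in>-L. m * c i)"
    using c m mL by (intro diff_mono sum_mono mult_right_mono) auto
  also have "(\<Sum>i\<in>L. m * (1 - c i)) - (\<Sum>i\<in>-L. m * c i) = m * (card L - (\<Sum>i\<in>UNIV. c i))"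
    by (simp add: split algebra_simps sum_subtractf sum_distrib_left)
  finally show ?thesis using m(2) s mult_nonneg_nonneg[of m "card L - (\<Sum>i\<in>UNIV. c i)"] by linarith
qed

lemma top_set_sum_ge_subset:
  fixes a :: "'m::finite \<Rightarrow> real"
  assumes "top_set a L" "\<And>i. 0 \<le> a i" "card S \<le> card L"
  shows "(\<Sum>i\<in>S. a i) \<le> (\<Sum>i\<in>L. a i)"
proof -
  have ind: "(\<Sum>i\<in>UNIV. h i * (if i \<in> S then 1 else 0)) = (\<Sum>i\<in>S. h i)" for h :: "'m \<Rightarrow> real"
    using sum.inter_restrict[of UNIV h S] by (simp add: if_distrib cong: if_cong)
  have "(\<Sum>i\<in>UNIV. a i * (if i \<in> S then 1 else 0)) \<le> (\<Sum>i\<in>L. a i)"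
    using ind[of "\<lambda>_. 1"] assms by (intro top_set_sum_ge) auto
  then show ?thesis by (simp only: ind)
qed

text \<open>The weight \<open>c i\<close> of \<open>X\<close> along \<open>t i\<close> is at most 1
  by Bessel, and by Parseval the weights sum to \<open>card X\<close>; they form a fractional
  selection of eigenvalues.\<close>

lemma ky_fan_maximum:
  fixes t :: "'m::finite \<Rightarrow> complex^'m" and X :: "(complex^'m) set"
  assumes t: "onf UNIV t" and a: "\<And>i. 0 \<le> a i" and L: "top_set a L"
    and X: "finite X" "onf X (\<lambda>x. x)" "card X \<le> card L"
  shows "(\<Sum>x\<in>X. Re (cip x (rank1sum a t *v x))) \<le> (\<Sum>i\<in>L. a i)"
proof -
  define c where "c i = (\<Sum>x\<in>X. (cmod (cip (t i) x))\<^sup>2)" for i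
  have "(\<Sum>x\<in>X. Re (cip x (rank1sum a t *v x))) = (\<Sum>x\<in>X. \<Sum>i\<in>UNIV. a i * (cmod (cip (t i) x))\<^sup>2)"
    by (simp add: rank1sum_form)
  also have "\<dots> = (\<Sum>i\<in>UNIV. a i * c i)"
    by (subst sum.swap) (simp add: c_def sum_distrib_left)
  also have "\<dots> \<le> (\<Sum>i\<in>L. a i)"
  proof (rule top_set_sum_ge[OF L a])
    show "0 \<le> c i" for i by (simp add: c_def sum_nonneg)
    show "c i \<le> 1" for i
      using bessel[OF X(2,1), of "t i"] onf_norm[OF t, of i]
      by (simp add: c_def norm_cip_commute[of "t i"])
    have "(\<Sum>i\<in>UNIV. c i) = (\<Sum>x\<in>X. \<Sum>i\<in>UNIV. (cmod (cip (t i) x))\<^sup>2)"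
      unfolding c_def by (rule sum.swap)
    also have "\<dots> = (\<Sum>x\<in>X. (norm x)\<^sup>2)" by (simp add: parseval t)
    also have "\<dots> = (\<Sum>x\<in>X. 1)" using onf_norm[OF X(2)] by (intro sum.cong) auto
    finally show "(\<Sum>i\<in>UNIV. c i) \<le> card L" using X(3) by simp
  qed
  finally show ?thesis .
qed

text \<open>For a positive semidefinite form \<open>q\<close>, Ky Fan's principle identifies this
  with a bound \<open>v\<close> on the sum of the \<open>k\<close> largest eigenvalues. Stating it
  for functions of vectors allows forms to be averaged, and allowing fewer than \<open>k\<close>
  vectors lets zero eigenvalues be dropped.\<close>

definition ky_fan_le :: "nat \<Rightarrow> (complex^'m::finite \<Rightarrow> real) \<Rightarrow> real \<Rightarrow> bool" where
  "ky_fan_le k q v \<longleftrightarrow>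
     (\<forall>X. finite X \<and> onf X (\<lambda>x. x) \<and> card X \<le> k \<longrightarrow> (\<Sum>x\<in>X. q x) \<le> v)"

lemma ky_fan_le_onf:
  assumes "ky_fan_le k q v" "finite K" "onf K t" "card K \<le> k"
  shows "(\<Sum>i\<in>K. q (t i)) \<le> v"
proof -
  have "(\<Sum>x\<in>t ` K. q x) \<le> v"
    using assms(1) onf_image[OF assms(3)] assms(2,4) card_image_le[OF assms(2), of t]
    unfolding ky_fan_le_def by (meson finite_imageI order_trans)
  then show ?thesis by (simp add: sum.reindex onf_inj[OF assms(3)])
qed

lemma onf_card_le:
  fixes X :: "(complex^'m::finite) set"
  assumes "finite X" "onf X (\<lambda>x. x)"
  shows "card X \<le> CARD('m)"
proof -
  have "vec.independent X"
  proof (rule vec.independent_if_scalars_zero[OF assms(1)])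
    fix c x assume "(\<Sum>x\<in>X. c x *s x) = 0" "x \<in> X"
    then show "c x = 0" using cip_onf_sum[OF assms(2,1), of x c] by simp
  qed
  then show ?thesis
    using vec.independent_span_bound[OF finite_cart_basis, of X] by (simp add: card_cart_basis)
qed

text \<open>Both sides are governed by the common nonzero eigenvalues of \<open>Z Z\<^sup>*\<close> and \<open>Z\<^sup>* Z\<close>.\<close>

lemma ky_fan_le_hadj:
  fixes Z :: "complex^'r::finite^'m::finite"
  assumes q: "ky_fan_le k (\<lambda>c. (norm (Z *v c))\<^sup>2) v"
  shows "ky_fan_le k (\<lambda>x. (norm (hadj Z *v x))\<^sup>2) v"
  unfolding ky_fan_le_def
proof (intro allI impI, elim conjE)
  fix X :: "(complex^'m) set"
  assume X: "finite X" "onf X (\<lambda>x. x)" "card X \<le> k"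
  define H where "H = Z ** hadj Z"
  have H: "psd H"
    unfolding H_def mult_adj_eq_rank1sum by (rule psd_rank1sum) simp
  then obtain t :: "'m \<Rightarrow> complex^'m" and l where t: "onf UNIV t" "H = rank1sum l t" "\<And>i. 0 \<le> l i"
    by (rule psd_spectral) (rule that)
  obtain L where L: "card L = card X" "top_set l L"
    using ex_top_set[OF onf_card_le[OF X(1,2)]] by blast
  \<comment> \<open>The image of \<open>t p\<close> under \<open>hadj Z\<close> has squared norm
    \<open>l p\<close> and can be normalised only if that is nonzero; the other indices contribute
    nothing to the sum.\<close>
  define M where "M = {p\<in>L. l p \<noteq> 0}"
  define c where "c p = of_real (1 / sqrt (l p)) *s (hadj Z *v t p)" for p
  have Ht: "H *v t p = of_real (l p) *s t p" for p by (simp add: t rank1sum_eigen)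
  have c_ip: "cip (hadj Z *v t p) (hadj Z *v t q) = (if p = q then of_real (l p) else 0)" for p q
  proof -
    have "cip (hadj Z *v t p) (hadj Z *v t q) = cip (t p) (H *v t q)"
      by (simp add: H_def matrix_vector_mul_assoc[symmetric] cip_hadj[of "t p" Z])
    then show ?thesis using onfD[OF t(1), of p q] by (simp add: Ht cip_scale_right)
  qed
  have sq: "complex_of_real (sqrt (l p)) * of_real (sqrt (l p)) = of_real (l p)" for p
    by (simp flip: of_real_mult add: t(3))
  have c_onf: "onf M c"
    unfolding onf_def c_def cip_scale_left cip_scale_right c_ip
    by (auto simp: M_def sq)
  have Zc: "(norm (Z *v c p))\<^sup>2 = l p" if "p \<in> M" for p
  proof -
    have "Z *v c p = of_real (1 / sqrt (l p)) *s (H *v t p)"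
      by (simp add: c_def H_def vector_scalar_commute matrix_vector_mul_assoc)
    then have "norm (Z *v c p) = 1 / sqrt (l p) * l p"
      using t(3)[of p] onf_norm[OF t(1), of p] by (simp add: Ht norm_scale norm_divide)
    then show ?thesis using that t(3)[of p] by (simp add: M_def power_divide power2_eq_square)
  qed
  have "(\<Sum>x\<in>X. (norm (hadj Z *v x))\<^sup>2) = (\<Sum>x\<in>X. Re (cip x (rank1sum l t *v x)))"
    by (simp add: norm_hadj_mult t(2)[symmetric] H_def)
  also have "\<dots> \<le> (\<Sum>p\<in>L. l p)"
    using L X by (intro ky_fan_maximum t) auto
  also have "\<dots> = (\<Sum>p\<in>M. l p)"
    unfolding M_def by (intro sum.mono_neutral_right) auto
  also have "\<dots> = (\<Sum>p\<in>M. (norm (Z *v c p))\<^sup>2)" by (simp add: Zc)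
  also have "\<dots> \<le> v"
  proof (rule ky_fan_le_onf[OF q _ c_onf])
    have "card M \<le> card L" unfolding M_def by (intro card_mono) auto
    then show "card M \<le> k" using L X by simp
  qed simp
  finally show "(\<Sum>x\<in>X. (norm (hadj Z *v x))\<^sup>2) \<le> v" .
qed

subsection \<open>A trace inequality for sums of rank-one matrices\<close>

lemma convex_scale_le:
  fixes g :: "real \<Rightarrow> real"
  assumes "convex_on {0..} g" "g 0 = 0" "0 \<le> p" "p \<le> 1" "0 \<le> m"
  shows "g (p * m) \<le> p * g m"
  using convex_onD[OF assms(1), of p 0 m] assms by simp

text \<open>Jensen's inequality in which the missing mass sits at 0, where \<open>g\<close>
  vanishes.\<close>

lemma convex_subweights:
  fixes g :: "real \<Rightarrow> real" and p x :: "'i::finite \<Rightarrow> real"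
  assumes g: "convex_on {0..} g" "g 0 = 0" and p: "\<And>i. 0 \<le> p i" "(\<Sum>i\<in>UNIV. p i) \<le> 1"
    and x: "\<And>i. 0 \<le> x i"
  shows "g (\<Sum>i\<in>UNIV. p i * x i) \<le> (\<Sum>i\<in>UNIV. p i * g (x i))"
proof (cases "(\<Sum>i\<in>UNIV. p i) = 0")
  case True
  then have "p i = 0" for i using sum_nonneg_eq_0_iff[of UNIV p] p by auto
  then show ?thesis by (simp add: g)
next
  case False
  define P where "P = (\<Sum>i\<in>UNIV. p i)"
  have P: "0 < P" "P \<le> 1" using False p sum_nonneg[of UNIV p] by (auto simp: P_def less_le)
  define m where "m = (\<Sum>i\<in>UNIV. (p i / P) *\<^sub>R x i)"
  have m: "0 \<le> m" using P p x by (auto simp: m_def intro!: sum_nonneg)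
  have "(\<Sum>i\<in>UNIV. p i * x i) = P * m"
    using P by (simp add: m_def sum_distrib_left)
  then have "g (\<Sum>i\<in>UNIV. p i * x i) \<le> P * g m"
    using convex_scale_le[OF g _ _ m, of P] P by simp
  also have "g m \<le> (\<Sum>i\<in>UNIV. p i / P * g (x i))"
    unfolding m_def
    using P p x by (intro convex_on_sum[OF _ _ g(1)])
      (auto simp: P_def[symmetric] simp flip: sum_divide_distrib)
  also have "P * (\<Sum>i\<in>UNIV. p i / P * g (x i)) = (\<Sum>i\<in>UNIV. p i * g (x i))"
    using P by (simp add: sum_distrib_left)
  finally show ?thesis using P by simp
qed

text \<open>The nonnegative array \<open>p\<close> writes each \<open>a r\<close> as a combination
  of the eigenvalues with weights summing to at most 1, while its sum over \<open>r\<close> is 1 for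
  every \<open>i\<close> with nonzero \<open>\<mu> i\<close>. Jensen for each \<open>r\<close>,
  summed over \<open>r\<close>, gives the claim.\<close>

lemma rank1sum_trace_convex:
  fixes t :: "'m::finite \<Rightarrow> complex^'m" and z :: "'r::finite \<Rightarrow> complex^'m"
  assumes t: "onf UNIV t" and \<mu>: "\<And>i. 0 \<le> \<mu> i" and z: "\<And>r. norm (z r) = 1"
    and a: "\<And>r. 0 \<le> a r" and T: "rank1sum a z = rank1sum \<mu> t"
    and g: "convex_on {0..} g" "g 0 = 0"
  shows "(\<Sum>r\<in>UNIV. g (a r)) \<le> (\<Sum>i\<in>UNIV. g (\<mu> i))"
proof -
  define w where "w i r = (cmod (cip (t i) (z r)))\<^sup>2" for i r
  define p where "p i r = (if \<mu> i = 0 then 0 else a r * w i r / \<mu> i)" for i r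
  have w0: "0 \<le> w i r" for i r by (simp add: w_def)
  have form: "(\<Sum>r\<in>UNIV. a r * (cmod (cip (z r) x))\<^sup>2) = (\<Sum>i\<in>UNIV. \<mu> i * (cmod (cip (t i) x))\<^sup>2)" for x
    using rank1sum_form[of x a z] rank1sum_form[of x \<mu> t] T by simp
  have col: "(\<Sum>r\<in>UNIV. a r * w i r) = \<mu> i" for i
  proof -
    have "(\<Sum>r\<in>UNIV. a r * w i r) = Re (cip (t i) (rank1sum \<mu> t *v t i))"
      by (simp add: T[symmetric] rank1sum_form w_def norm_cip_commute[of "t i"])
    then show ?thesis using onfD[OF t, of i i] by (simp add: rank1sum_eigen t cip_scale_right)
  qed
  have zero: "a r * w i r = 0" if "\<mu> i = 0" for i r
    using col[of i] that sum_nonneg_eq_0_iff[of UNIV "\<lambda>r. a r * w i r"] a w0 by auto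
  have pm: "p i r * \<mu> i = a r * w i r" for i r
    using zero by (auto simp: p_def)
  have row_mean: "(\<Sum>i\<in>UNIV. p i r * \<mu> i) = a r" for r
    using parseval[OF t, of "z r"] by (simp add: pm w_def z flip: sum_distrib_left)
  have p0: "0 \<le> p i r" for i r using \<mu> a w0 by (simp add: p_def)
  have row: "(\<Sum>i\<in>UNIV. p i r) \<le> 1" for r
  proof -
    \<comment> \<open>\<open>y\<close> is the pseudoinverse of the matrix applied to
      \<open>z r\<close>, and \<open>q\<close> is its inner product with \<open>z r\<close>. The
      quadratic form at \<open>y\<close> equals \<open>q\<close> and contains the single term
      \<open>a r * q\<^sup>2\<close>, which forces \<open>a r * q \<le> 1\<close>.\<close>
    define y where "y = (\<Sum>i\<in>UNIV. (if \<mu> i = 0 then 0 else cip (t i) (z r) / of_real (\<mu> i)) *s t i)"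
    define q where "q = (\<Sum>i\<in>UNIV. if \<mu> i = 0 then 0 else w i r / \<mu> i)"
    have ty: "cip (t i) y = (if \<mu> i = 0 then 0 else cip (t i) (z r) / of_real (\<mu> i))" for i
      unfolding y_def by (rule cip_onf_sum[OF t]) auto
    have "cip (z r) y = (\<Sum>i\<in>UNIV. of_real (if \<mu> i = 0 then 0 else w i r / \<mu> i))"
      unfolding y_def cip_sum_right cip_scale_right
      by (intro sum.cong refl)
         (simp add: w_def of_real_cmod_square cnj_cip)
    then have zy: "cip (z r) y = of_real q" by (simp add: q_def)
    have "a r * q\<^sup>2 = a r * (cmod (cip (z r) y))\<^sup>2" by (simp add: zy)
    also have "\<dots> \<le> (\<Sum>s\<in>UNIV. a s * (cmod (cip (z s) y))\<^sup>2)"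
      using a by (intro member_le_sum) auto
    also have "\<dots> = (\<Sum>i\<in>UNIV. \<mu> i * (cmod (cip (t i) y))\<^sup>2)" by (rule form)
    also have "\<dots> = q" unfolding q_def ty
      by (intro sum.cong refl) (simp add: w_def norm_divide power_divide power2_eq_square)
    finally have le: "a r * q\<^sup>2 \<le> q" .
    have "q \<ge> 0" unfolding q_def using w0 \<mu> by (intro sum_nonneg) auto
    then have "a r * q \<le> 1"
      using le by (cases "q = 0") (auto simp: power2_eq_square mult.assoc[symmetric])
    moreover have "(\<Sum>i\<in>UNIV. p i r) = a r * q"
      unfolding q_def p_def sum_distrib_left by (intro sum.cong) auto
    ultimately show ?thesis by simp
  qed
  have "(\<Sum>r\<in>UNIV. g (a r)) \<le> (\<Sum>r\<in>UNIV. \<Sum>i\<in>UNIV. p i r * g (\<mu> i))"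
  proof (intro sum_mono)
    fix r
    show "g (a r) \<le> (\<Sum>i\<in>UNIV. p i r * g (\<mu> i))"
      using convex_subweights[OF g p0 row, of \<mu> r, OF \<mu>] by (simp only: row_mean)
  qed
  also have "\<dots> = (\<Sum>i\<in>UNIV. g (\<mu> i) * (\<Sum>r\<in>UNIV. p i r))"
    by (subst sum.swap) (simp add: sum_distrib_left mult.commute)
  also have "\<dots> = (\<Sum>i\<in>UNIV. g (\<mu> i))"
  proof (intro sum.cong refl)
    fix i
    have "(\<Sum>r\<in>UNIV. p i r) = 1" if "\<mu> i \<noteq> 0"
      using that col[of i] by (simp add: p_def flip: sum_divide_distrib)
    then show "g (\<mu> i) * (\<Sum>r\<in>UNIV. p i r) = g (\<mu> i)"
      by (cases "\<mu> i = 0") (auto simp: g)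
  qed
  finally show ?thesis .
qed

lemma concave_scale_ge:
  fixes f :: "real \<Rightarrow> real"
  assumes "concave_on {0..} f" "f 0 = 0" "0 \<le> p" "p \<le> 1" "0 \<le> m"
  shows "p * f m \<le> f (p * m)"
  using concave_onD[OF assms(1), of p 0 m] assms by simp

text \<open>Below the threshold \<open>b\<close> separating the Ky Fan eigenvalues from the rest, \<open>f\<close> is replaced by its
  chord; the defect \<open>g\<close> is convex and vanishes on the remaining eigenvalues, so the trace inequality
  for \<open>g\<close> involves only the eigenvalues in \<open>L\<close>.\<close>

lemma rank1sum_ky_fan_concave:
  fixes t :: "'m::finite \<Rightarrow> complex^'m" and z :: "'r::finite \<Rightarrow> complex^'m"
  assumes t: "onf UNIV t" and \<mu>: "\<And>i. 0 \<le> \<mu> i" and z: "\<And>r. norm (z r) = 1"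
    and a: "\<And>r. 0 \<le> a r" and T: "rank1sum a z = rank1sum \<mu> t"
    and f: "concave_on {0..} f" "f 0 = 0" and L: "top_set \<mu> L"
  shows "(\<Sum>i\<in>L. f (\<mu> i)) \<le> (\<Sum>i\<in>L. \<Sum>r\<in>UNIV. f (a r) * (cmod (cip (t i) (z r)))\<^sup>2)"
proof -
  \<comment> \<open>\<open>b\<close> is the least nonzero eigenvalue in \<open>L\<close>. If there
    is none, any positive bound for the eigenvalues outside \<open>L\<close> serves; positivity is
    needed for the slope \<open>f b / b\<close>.\<close>
  obtain b where b: "0 < b" "\<And>i. i \<in> L \<Longrightarrow> \<mu> i = 0 \<or> b \<le> \<mu> i" "\<And>i. i \<notin> L \<Longrightarrow> \<mu> i \<le> b"
  proof -
    let ?P = "\<mu> ` {i\<in>L. \<mu> i \<noteq> 0}"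
    show ?thesis
    proof (cases "?P = {}")
      case True
      show ?thesis
      proof (cases "L = {}")
        case True
        have "\<mu> i \<le> Max (insert 1 (range \<mu>))" for i by (intro Max_ge) auto
        moreover have "0 < Max (insert 1 (range \<mu>))"
          by (rule less_le_trans[OF zero_less_one Max_ge]) auto
        ultimately show ?thesis using that[of "Max (insert 1 (range \<mu>))"] True by blast
      next
        case False
        then obtain i where i: "i \<in> L" by blast
        then have "\<mu> i = 0" using True by blast
        then have "\<mu> j \<le> 1" if "j \<notin> L" for j using L i that by (force simp: top_set_def)
        then show ?thesis using that[of 1] True by auto
      qed
    next
      case False
      have M: "Min ?P \<in> ?P" using False by (intro Min_in) auto
      then obtain i where i: "i \<in> L" "\<mu> i \<noteq> 0" "Min ?P = \<mu> i" by auto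
      show ?thesis
      proof (rule that[of "Min ?P"])
        show "0 < Min ?P" using i \<mu>[of i] by simp
        show "\<mu> j = 0 \<or> Min ?P \<le> \<mu> j" if "j \<in> L" for j
          using that by (cases "\<mu> j = 0") (auto intro!: Min_le)
        show "\<mu> j \<le> Min ?P" if "j \<notin> L" for j using L i that by (auto simp: top_set_def)
      qed
    qed
  qed
  define c where "c = f b / b"
  \<comment> \<open>By concavity \<open>f\<close> lies above the chord through 0 and
    \<open>b\<close> up to \<open>b\<close>, and below it afterwards. Hence the positive part
    vanishes up to \<open>b\<close> and is the full difference beyond.\<close>
  define g where "g x = max 0 (c * x - f x)" for x
  have below: "c * x \<le> f x" if "0 \<le> x" "x \<le> b" for x
    using concave_scale_ge[OF f, of "x / b" b] that b(1) by (simp add: c_def field_simps)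
  have above: "f x \<le> c * x" if "b \<le> x" for x
    using concave_scale_ge[OF f, of "b / x" x] that b(1) by (simp add: c_def field_simps)
  have h: "convex_on {0..} (\<lambda>x. c * x - f x)"
    using f(1) unfolding concave_on_def convex_on_def by (auto simp: algebra_simps)
  have gconv: "convex_on {0..} g"
  proof (rule convex_onI)
    fix s x y :: real
    assume s: "0 < s" "s < 1" and xy: "x \<in> {0..}" "y \<in> {0..}"
    have "c * ((1 - s) *\<^sub>R x + s *\<^sub>R y) - f ((1 - s) *\<^sub>R x + s *\<^sub>R y)
        \<le> (1 - s) * (c * x - f x) + s * (c * y - f y)"
      using convex_onD[OF h, of s x y] s xy by simp
    also have "\<dots> \<le> (1 - s) * g x + s * g y"
      using s by (intro add_mono mult_left_mono) (auto simp: g_def)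
    finally show "g ((1 - s) *\<^sub>R x + s *\<^sub>R y) \<le> (1 - s) * g x + s * g y"
      using s by (simp add: g_def[of "(1 - s) *\<^sub>R x + s *\<^sub>R y"]) (simp add: g_def)
  qed simp
  have g0: "g 0 = 0" "\<And>x. 0 \<le> g x" by (auto simp: g_def f)
  have f_ge: "c * x - g x \<le> f x" for x by (simp add: g_def)
  have fL: "f (\<mu> i) = c * \<mu> i - g (\<mu> i)" if "i \<in> L" for i
    using b(2)[OF that] above[of "\<mu> i"] by (auto simp: g_def f)
  have gL: "g (\<mu> i) = 0" if "i \<notin> L" for i
    using below[of "\<mu> i"] b(3)[OF that] \<mu>[of i] by (simp add: g_def)
  have \<mu>i: "\<mu> i = (\<Sum>r\<in>UNIV. a r * (cmod (cip (t i) (z r)))\<^sup>2)" for i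
  proof -
    have "(\<Sum>r\<in>UNIV. a r * (cmod (cip (t i) (z r)))\<^sup>2) = Re (cip (t i) (rank1sum \<mu> t *v t i))"
      by (simp add: T[symmetric] rank1sum_form norm_cip_commute[of "t i"])
    then show ?thesis using onfD[OF t, of i i] by (simp add: rank1sum_eigen t cip_scale_right)
  qed
  have "(\<Sum>i\<in>L. \<Sum>r\<in>UNIV. g (a r) * (cmod (cip (t i) (z r)))\<^sup>2)
      = (\<Sum>r\<in>UNIV. g (a r) * (\<Sum>i\<in>L. (cmod (cip (t i) (z r)))\<^sup>2))"
    by (subst sum.swap) (simp add: sum_distrib_left)
  \<comment> \<open>Bessel for the vectors \<open>t i\<close> with \<open>i\<close> in
    \<open>L\<close>, tested on the unit vector \<open>z r\<close>.\<close>
  also have "\<dots> \<le> (\<Sum>r\<in>UNIV. g (a r) * 1)"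
    using bessel[OF onf_subset[OF t, of L]] z g0(2) by (intro sum_mono mult_left_mono) (simp_all, metis one_power2)
  also have "\<dots> \<le> (\<Sum>i\<in>UNIV. g (\<mu> i))"
    using rank1sum_trace_convex[OF t \<mu> z a T gconv g0(1)] by simp
  also have "\<dots> = (\<Sum>i\<in>L. g (\<mu> i))"
    using gL by (intro sum.mono_neutral_right) auto
  finally have gle: "(\<Sum>i\<in>L. \<Sum>r\<in>UNIV. g (a r) * (cmod (cip (t i) (z r)))\<^sup>2) \<le> (\<Sum>i\<in>L. g (\<mu> i))" .
  have "(\<Sum>i\<in>L. f (\<mu> i)) = (\<Sum>i\<in>L. c * \<mu> i) - (\<Sum>i\<in>L. g (\<mu> i))"
    by (simp add: fL sum_subtractf)
  also have "\<dots> \<le> (\<Sum>i\<in>L. c * \<mu> i) - (\<Sum>i\<in>L. \<Sum>r\<in>UNIV. g (a r) * (cmod (cip (t i) (z r)))\<^sup>2)"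
    using gle by simp
  also have "\<dots> = (\<Sum>i\<in>L. \<Sum>r\<in>UNIV. (c * a r - g (a r)) * (cmod (cip (t i) (z r)))\<^sup>2)"
    by (subst \<mu>i) (simp add: sum_distrib_left left_diff_distrib sum_subtractf mult.assoc)
  also have "\<dots> \<le> (\<Sum>i\<in>L. \<Sum>r\<in>UNIV. f (a r) * (cmod (cip (t i) (z r)))\<^sup>2)"
    using f_ge by (intro sum_mono mult_right_mono) auto
  finally show ?thesis .
qed

subsection \<open>Monotonicity of eigenvalues\<close>

text \<open>Gaussian elimination: an equation with a nonzero coefficient at \<open>i0\<close> is
  solved for that unknown and substituted into the others.\<close>

lemma homogeneous_system_solution:
  fixes M :: "'p \<Rightarrow> 'i \<Rightarrow> 'a::field"
  assumes "finite Q" "finite K" "card Q < card K"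
  shows "\<exists>c. (\<exists>i\<in>K. c i \<noteq> 0) \<and> (\<forall>p\<in>Q. (\<Sum>i\<in>K. c i * M p i) = 0)"
  using assms
proof (induction Q arbitrary: K M rule: finite_induct)
  case empty
  then obtain i where "i \<in> K" by fastforce
  then show ?case by (intro exI[of _ "\<lambda>_. 1"]) auto
next
  case (insert p Q)
  show ?case
  proof (cases "\<forall>i\<in>K. M p i = 0")
    case True
    then show ?thesis
      using insert.IH[of K M] insert.hyps insert.prems by (auto simp: card_insert_disjoint)
  next
    case False
    then obtain i0 where i0: "i0 \<in> K" "M p i0 \<noteq> 0" by blast
    define K' where "K' = K - {i0}"
    have K: "K = insert i0 K'" "i0 \<notin> K'" "finite K'" using i0 insert.prems by (auto simp: K'_def)
    have "card Q < card K'" using insert.hyps insert.prems K by auto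
    from insert.IH[OF K(3) this, of "\<lambda>q i. M q i - M q i0 * M p i / M p i0"]
    obtain c where c: "\<exists>i\<in>K'. c i \<noteq> 0"
      "\<And>q. q \<in> Q \<Longrightarrow> (\<Sum>i\<in>K'. c i * (M q i - M q i0 * M p i / M p i0)) = 0" by blast
    define d where "d = - (\<Sum>i\<in>K'. c i * M p i) / M p i0"
    have s: "(\<Sum>i\<in>K. (c(i0 := d)) i * M q i) = d * M q i0 + (\<Sum>i\<in>K'. c i * M q i)" for q
    proof -
      have "(\<Sum>i\<in>K'. (c(i0 := d)) i * M q i) = (\<Sum>i\<in>K'. c i * M q i)"
        using K by (intro sum.cong) auto
      then show ?thesis using K by simp
    qed
    have "(\<Sum>i\<in>K. (c(i0 := d)) i * M p i) = 0"
      unfolding s using i0 by (simp add: d_def)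
    moreover have "(\<Sum>i\<in>K. (c(i0 := d)) i * M q i) = 0" if "q \<in> Q" for q
    proof -
      have "(\<Sum>i\<in>K'. c i * M q i) - M q i0 / M p i0 * (\<Sum>i\<in>K'. c i * M p i) = 0"
        using c(2)[OF that] by (simp add: algebra_simps sum_subtractf sum_distrib_left)
      then show ?thesis unfolding s by (simp add: d_def)
    qed
    moreover have "\<exists>i\<in>K. (c(i0 := d)) i \<noteq> 0" using c(1) K by auto
    ultimately show ?thesis by (intro exI[of _ "c(i0 := d)"]) auto
  qed
qed

text \<open>A dimension count in the style of Courant and Fischer. If the count failed, some nonzero
  combination of the \<open>e i\<close> with \<open>h \<le> s i\<close> would be orthogonal to every
  \<open>t p\<close> with \<open>h \<le> \<mu> p\<close>, and the form there would be both at least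
  and strictly less than \<open>h\<close> times the squared norm.\<close>

lemma eigenvalue_count_mono:
  fixes t :: "'m::finite \<Rightarrow> complex^'m"
  assumes t: "onf UNIV t" and e: "onf K e" "finite K"
    and ge: "\<And>c. (\<Sum>i\<in>K. s i * (cmod (c i))\<^sup>2)
        \<le> Re (cip (\<Sum>i\<in>K. c i *s e i) (rank1sum \<mu> t *v (\<Sum>i\<in>K. c i *s e i)))"
  shows "card {i\<in>K. h \<le> s i} \<le> card {p. h \<le> \<mu> p}"
proof (rule ccontr)
  let ?K = "{i\<in>K. h \<le> s i}" and ?Q = "{p. h \<le> \<mu> p}"
  assume "\<not> ?thesis"
  then obtain c where c: "\<exists>i\<in>?K. c i \<noteq> 0" "\<And>p. p \<in> ?Q \<Longrightarrow> (\<Sum>i\<in>?K. c i * cip (t p) (e i)) = 0"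
    using homogeneous_system_solution[of ?Q ?K "\<lambda>p i. cip (t p) (e i)"] e(2) by auto
  define d where "d i = (if h \<le> s i then c i else 0)" for i
  define x where "x = (\<Sum>i\<in>K. d i *s e i)"
  have restrict: "(\<Sum>i\<in>K. F i) = (\<Sum>i\<in>?K. F i)"
    if "\<And>i. \<not> h \<le> s i \<Longrightarrow> F i = 0" for F :: "_ \<Rightarrow> complex"
    using e(2) that by (intro sum.mono_neutral_right) auto
  have "cip (t p) x = (\<Sum>i\<in>?K. d i * cip (t p) (e i))" for p
    unfolding x_def cip_sum_right cip_scale_right by (rule restrict) (simp add: d_def)
  then have orth: "cip (t p) x = 0" if "p \<in> ?Q" for p
    using c(2)[OF that] by (simp add: d_def)
  have nx: "(norm x)\<^sup>2 = (\<Sum>i\<in>K. (cmod (d i))\<^sup>2)"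
    unfolding x_def by (rule norm_onf_sum[OF e])
  obtain i where i: "i \<in> ?K" "c i \<noteq> 0" using c(1) by blast
  have "0 < (cmod (d i))\<^sup>2" using i by (simp add: d_def)
  also have "\<dots> \<le> (norm x)\<^sup>2" unfolding nx using i e(2) by (intro member_le_sum) auto
  finally have xpos: "0 < (\<Sum>p\<in>UNIV. (cmod (cip (t p) x))\<^sup>2)" by (simp add: parseval t)
  have "h * (norm x)\<^sup>2 \<le> (\<Sum>i\<in>K. s i * (cmod (d i))\<^sup>2)"
    unfolding nx sum_distrib_left by (intro sum_mono) (auto simp: d_def mult_right_mono)
  also have "\<dots> \<le> (\<Sum>p\<in>UNIV. \<mu> p * (cmod (cip (t p) x))\<^sup>2)"
    using ge[of d] by (simp add: x_def[symmetric] rank1sum_form)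
  also have "\<dots> < (\<Sum>p\<in>UNIV. h * (cmod (cip (t p) x))\<^sup>2)"
  proof (rule sum_strict_mono_ex1)
    show "\<forall>p\<in>UNIV. \<mu> p * (cmod (cip (t p) x))\<^sup>2 \<le> h * (cmod (cip (t p) x))\<^sup>2"
    proof
      fix p
      show "\<mu> p * (cmod (cip (t p) x))\<^sup>2 \<le> h * (cmod (cip (t p) x))\<^sup>2"
        using orth[of p] by (cases "h \<le> \<mu> p") (simp_all add: mult_right_mono)
    qed
    have "\<exists>p. cip (t p) x \<noteq> 0" using xpos by (rule contrapos_pp) simp
    then obtain p where p: "cip (t p) x \<noteq> 0" by blast
    then have "\<mu> p < h" using orth[of p] by (cases "h \<le> \<mu> p") auto
    then show "\<exists>p\<in>UNIV. \<mu> p * (cmod (cip (t p) x))\<^sup>2 < h * (cmod (cip (t p) x))\<^sup>2"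
      using p by (intro bexI[of _ p]) auto
  qed simp
  also have "\<dots> = h * (norm x)\<^sup>2" by (simp add: parseval t flip: sum_distrib_left)
  finally show False by simp
qed

text \<open>Induction removing an index \<open>i0\<close> with smallest \<open>s\<close>. At the
  threshold \<open>s i0\<close> all of \<open>K\<close> is counted, so a value of
  \<open>\<mu>\<close> that large is still free after the rest has been placed.\<close>

lemma injection_from_counts:
  fixes s :: "'i \<Rightarrow> real" and \<mu> :: "'m::finite \<Rightarrow> real"
  assumes "finite K" "\<And>h. card {i\<in>K. h \<le> s i} \<le> card {p. h \<le> \<mu> p}"
  shows "\<exists>\<iota>. inj_on \<iota> K \<and> (\<forall>i\<in>K. s i \<le> \<mu> (\<iota> i))"
  using assms
proof (induction "card K" arbitrary: K)
  case 0
  then show ?case by simp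
next
  case (Suc k)
  have ne: "s ` K \<noteq> {}" "finite (s ` K)" using Suc.hyps(2) Suc.prems(1) by auto
  then have "Min (s ` K) \<in> s ` K" by (intro Min_in)
  then obtain i0 where i0: "i0 \<in> K" "s i0 = Min (s ` K)" by (metis imageE)
  have min: "s i0 \<le> s i" if "i \<in> K" for i using i0(2) that ne by simp
  define K' where "K' = K - {i0}"
  have K: "K = insert i0 K'" "i0 \<notin> K'" "finite K'" using i0 Suc.prems by (auto simp: K'_def)
  have ck: "k = card K'" using Suc.hyps(2) K by simp
  have "card {i\<in>K'. h \<le> s i} \<le> card {p. h \<le> \<mu> p}" for h
    by (rule order_trans[OF card_mono Suc.prems(2)]) (use K in auto)
  from Suc.hyps(1)[OF ck K(3) this] obtain \<iota> where
    \<iota>: "inj_on \<iota> K'" "\<forall>i\<in>K'. s i \<le> \<mu> (\<iota> i)" by blast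
  have "card (\<iota> ` K') < card K" using K by (simp add: card_image \<iota>)
  also have "card K = card {i\<in>K. s i0 \<le> s i}" using min by (intro arg_cong[of _ _ card]) auto
  also have "\<dots> \<le> card {p. s i0 \<le> \<mu> p}" by (rule Suc.prems(2))
  finally have lt: "card (\<iota> ` K') < card {p. s i0 \<le> \<mu> p}" .
  have "\<not> {p. s i0 \<le> \<mu> p} \<subseteq> \<iota> ` K'"
  proof
    assume "{p. s i0 \<le> \<mu> p} \<subseteq> \<iota> ` K'"
    then have "card {p. s i0 \<le> \<mu> p} \<le> card (\<iota> ` K')" by (intro card_mono) auto
    then show False using lt by simp
  qed
  then obtain p where p: "s i0 \<le> \<mu> p" "p \<notin> \<iota> ` K'" by blast
  have "inj_on (\<iota>(i0 := p)) K" unfolding K(1)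
    using \<iota>(1) p(2) K(2) by (auto simp: inj_on_def)
  moreover have "\<forall>i\<in>K. s i \<le> \<mu> ((\<iota>(i0 := p)) i)" using \<iota>(2) p(1) K by auto
  ultimately show ?case by blast
qed

subsection \<open>Doubling the dimension\<close>

definition vjoin :: "complex^'n::finite \<Rightarrow> complex^'n \<Rightarrow> complex^('n + 'n)" where
  "vjoin x y = (\<chi> r. case r of Inl i \<Rightarrow> x $ i | Inr i \<Rightarrow> y $ i)"

lemma sum_UNIV_Plus:
  fixes h :: "'a::finite + 'b::finite \<Rightarrow> 'c::comm_monoid_add"
  shows "(\<Sum>r\<in>UNIV. h r) = (\<Sum>i\<in>UNIV. h (Inl i)) + (\<Sum>i\<in>UNIV. h (Inr i))"
  unfolding UNIV_Plus_UNIV[symmetric] by (subst sum.Plus) (simp_all add: o_def)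

lemma cip_vjoin: "cip (vjoin a b) (vjoin c d) = cip a c + cip b d"
  by (simp add: cip_def vjoin_def sum_UNIV_Plus)

lemma vjoin_add: "vjoin (a + b) (c + d) = vjoin a c + vjoin b d"
  by (auto simp: vjoin_def vec_eq_iff split: sum.split)

lemma vjoin_scale: "vjoin (c *s a) (c *s b) = c *s vjoin a b"
  by (auto simp: vjoin_def vec_eq_iff split: sum.split)

lemma vjoin_zero: "vjoin 0 0 = 0"
  by (auto simp: vjoin_def vec_eq_iff split: sum.split)

lemma vjoin_sum: "vjoin (\<Sum>i\<in>K. x i) (\<Sum>i\<in>K. y i) = (\<Sum>i\<in>K. vjoin (x i) (y i))"
  by (induction K rule: infinite_finite_induct) (auto simp: vjoin_zero vjoin_add)

text \<open>The factor makes a joined pair of unit vectors a unit vector and keeps joined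
  orthonormal families orthonormal.\<close>

definition hjoin :: "complex^'n::finite \<Rightarrow> complex^'n \<Rightarrow> complex^('n + 'n)" where
  "hjoin x y = of_real (1 / sqrt 2) *s vjoin x y"

lemma inv_sqrt2_square: "complex_of_real (1 / sqrt 2) * of_real (1 / sqrt 2) = 1 / 2"
  by (simp flip: of_real_mult)

lemma cip_hjoin: "cip (hjoin a b) (hjoin c d) = (cip a c + cip b d) / 2"
proof -
  have "cip (hjoin a b) (hjoin c d)
      = (complex_of_real (1 / sqrt 2) * of_real (1 / sqrt 2)) * (cip a c + cip b d)"
    unfolding hjoin_def cip_scale_left cip_scale_right cip_vjoin by simp
  then show ?thesis unfolding inv_sqrt2_square by simp
qed

lemma hjoin_sum_scale:
  "(\<Sum>i\<in>K. c i *s hjoin (x i) (y i)) = hjoin (\<Sum>i\<in>K. c i *s x i) (\<Sum>i\<in>K. c i *s y i)"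
  by (simp add: hjoin_def vjoin_sum vjoin_scale vec.scale_sum_right vec.scale_scale mult.commute)

lemma norm_hjoin: "(norm (hjoin x y))\<^sup>2 = ((norm x)\<^sup>2 + (norm y)\<^sup>2) / 2"
proof -
  have "complex_of_real ((norm (hjoin x y))\<^sup>2) = of_real (((norm x)\<^sup>2 + (norm y)\<^sup>2) / 2)"
    using cip_hjoin[of x y x y] unfolding cip_self by (simp only: of_real_add of_real_divide of_real_numeral)
  then show ?thesis using of_real_eq_iff by blast
qed

section \<open>Matrices with prescribed columns\<close>

definition colmat :: "('r::finite \<Rightarrow> complex^'m::finite) \<Rightarrow> complex^'r^'m" where
  "colmat z = (\<chi> i r. z r $ i)"

lemma norm_hadj_colmat: "(norm (hadj (colmat z) *v x))\<^sup>2 = (\<Sum>r\<in>UNIV. (cmod (cip (z r) x))\<^sup>2)"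
proof -
  have "(hadj (colmat z) *v x) $ r = cip (z r) x" for r
    by (simp add: hadj_def colmat_def matrix_vector_mult_def cip_def)
  then show ?thesis by (simp add: norm_vec_def L2_set_def sum_nonneg)
qed

text \<open>Absorbing the square roots of the weights into the columns puts the form of
  \<open>rank1sum h z\<close> into the shape required by \<open>ky_fan_le_hadj\<close>.\<close>

lemma norm_hadj_colmat_sqrt:
  assumes "\<And>r. 0 \<le> h r"
  shows "(norm (hadj (colmat (\<lambda>r. of_real (sqrt (h r)) *s z r)) *v x))\<^sup>2
    = (\<Sum>r\<in>UNIV. h r * (cmod (cip (z r) x))\<^sup>2)"
  by (simp add: norm_hadj_colmat cip_scale_left norm_mult power_mult_distrib assms)

lemma colmat_mult: "colmat z *v c = (\<Sum>r\<in>UNIV. c $ r *s z r)"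
  by (simp add: colmat_def matrix_vector_mult_def vec_eq_iff mult.commute)

text \<open>Sum \<open>4 Re (cnj p * q) \<le> |p + q|\<^sup>2\<close> over the singular vectors of \<open>A\<close>.\<close>

lemma singular_form_le:
  fixes u w :: "'n::finite \<Rightarrow> complex^'n"
  assumes w: "onf UNIV w" and a: "\<And>i. 0 \<le> a i" and A: "\<And>i. A *v w i = of_real (a i) *s u i"
  shows "Re (cip x (A *v y)) \<le> (\<Sum>i\<in>UNIV. a i * (cmod (cip (hjoin (u i) (w i)) (hjoin x y)))\<^sup>2)"
proof -
  have "A *v y = A *v (\<Sum>i\<in>UNIV. cip (w i) y *s w i)" by (simp add: onf_expand w)
  also have "\<dots> = (\<Sum>i\<in>UNIV. cip (w i) y *s (A *v w i))"
    by (simp add: vec.linear_sum[OF matrix_vector_mul_linear_gen] vector_scalar_commute)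
  finally have "Re (cip x (A *v y)) = (\<Sum>i\<in>UNIV. a i * Re (cip x (u i) * cip (w i) y))"
    by (simp add: A cip_sum_right cip_scale_right algebra_simps)
  also have "\<dots> \<le> (\<Sum>i\<in>UNIV. a i * (cmod (cip (hjoin (u i) (w i)) (hjoin x y)))\<^sup>2)"
  proof (intro sum_mono mult_left_mono a)
    fix i
    define p q where "p = cip (u i) x" and "q = cip (w i) y"
    have "cip x (u i) = cnj p" by (simp add: p_def cnj_cip)
    moreover have "4 * Re (cnj p * q) \<le> (cmod (p + q))\<^sup>2"
      using zero_le_power2[of "Re p - Re q"] zero_le_power2[of "Im p - Im q"]
      unfolding cmod_power2 by (simp add: power2_eq_square algebra_simps)
    ultimately show "Re (cip x (u i) * cip (w i) y) \<le> (cmod (cip (hjoin (u i) (w i)) (hjoin x y)))\<^sup>2"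
      by (simp add: cip_hjoin p_def[symmetric] q_def[symmetric] norm_divide power_divide)
  qed
  finally show ?thesis .
qed

subsection \<open>Subadditivity of Ky Fan sums\<close>

text \<open>The conclusion is weak majorization of the values \<open>g (s i)\<close> by the
  eigenvalues \<open>\<phi>\<close>. Monotonicity of \<open>g\<close> carries the comparison of
  singular values with eigenvalues in the doubled space over to their images.\<close>

theorem ky_fan_subadditive:
  fixes A B :: "'n::finite cmat" and v \<omega> :: "'n \<Rightarrow> complex^'n" and K :: "'n set"
  assumes A: "normal_mat A" and B: "normal_mat B"
    and g: "concave_on {0..} g" "g 0 = 0" "mono_on {0..} g"
    and v: "onf UNIV v" "\<And>i. 0 \<le> s i" "adj (A + B) ** (A + B) = rank1sum (\<lambda>i. (s i)\<^sup>2) v"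
    and F: "mat_fun g (mat_abs A) + mat_fun g (mat_abs B) = rank1sum \<phi> \<omega>" "onf UNIV \<omega>"
  shows "\<exists>L. card L = card K \<and> (\<Sum>i\<in>K. g (s i)) \<le> (\<Sum>j\<in>L. \<phi> j)"
proof -
  have gpos: "0 \<le> g x" if "0 \<le> x" for x
    using mono_onD[OF g(3), of 0 x] that g(2) by simp
  obtain uA wA :: "'n \<Rightarrow> complex^'n" and aA where sA: "onf UNIV uA" "onf UNIV wA" "\<And>i. 0 \<le> aA i"
    "mat_abs A = rank1sum aA wA" "mat_abs A = rank1sum aA uA"
    "\<And>i. A *v wA i = of_real (aA i) *s uA i"
    by (rule normal_singular_vectors[OF A]) (rule that)
  obtain uB wB :: "'n \<Rightarrow> complex^'n" and aB where sB: "onf UNIV uB" "onf UNIV wB" "\<And>i. 0 \<le> aB i"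
    "mat_abs B = rank1sum aB wB" "mat_abs B = rank1sum aB uB"
    "\<And>i. B *v wB i = of_real (aB i) *s uB i"
    by (rule normal_singular_vectors[OF B]) (rule that)
  define a where "a = case_sum aA aB"
  define u where "u = case_sum uA uB"
  define w where "w = case_sum wA wB"
  define z where "z r = hjoin (u r) (w r)" for r
  have a0: "0 \<le> a r" for r using sA(3) sB(3) by (auto simp: a_def split: sum.split)
  have nu: "norm (u r) = 1" for r
    using onf_norm[OF sA(1)] onf_norm[OF sB(1)] by (auto simp: u_def split: sum.split)
  have nw: "norm (w r) = 1" for r
    using onf_norm[OF sA(2)] onf_norm[OF sB(2)] by (auto simp: w_def split: sum.split)
  have nz: "norm (z r) = 1" for r
  proof -
    have "(norm (z r))\<^sup>2 = 1" by (simp add: z_def norm_hjoin nu nw)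
    then show ?thesis by (simp add: power2_eq_1_iff) (metis norm_ge_zero neg_0_le_iff_le not_one_le_zero)
  qed
  \<comment> \<open>The same matrix is expanded in the right singular vectors here and in the left
    ones in \<open>Fu\<close>; having both expansions is what normality of \<open>A\<close> and
    \<open>B\<close> provides.\<close>
  have Fw: "Re (cip x (rank1sum \<phi> \<omega> *v x)) = (\<Sum>r\<in>UNIV. g (a r) * (cmod (cip (w r) x))\<^sup>2)" for x
    unfolding F(1)[symmetric] sA(4) sB(4) mat_fun_rank1sum[OF sA(2,3)] mat_fun_rank1sum[OF sB(2,3)]
    by (simp add: matrix_vector_mult_add_rdistrib cip_add_right rank1sum_form sum_UNIV_Plus a_def w_def)
  have Fu: "Re (cip x (rank1sum \<phi> \<omega> *v x)) = (\<Sum>r\<in>UNIV. g (a r) * (cmod (cip (u r) x))\<^sup>2)" for x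
    unfolding F(1)[symmetric] sA(5) sB(5) mat_fun_rank1sum[OF sA(1,3)] mat_fun_rank1sum[OF sB(1,3)]
    by (simp add: matrix_vector_mult_add_rdistrib cip_add_right rank1sum_form sum_UNIV_Plus a_def u_def)
  have \<phi>: "0 \<le> \<phi> j" for j
  proof -
    have "0 \<le> Re (cip (\<omega> j) (rank1sum \<phi> \<omega> *v \<omega> j))"
      unfolding Fw using gpos a0 by (intro sum_nonneg) simp
    then show ?thesis using onfD[OF F(2), of j j]
      by (simp add: rank1sum_eigen F(2) cip_scale_right)
  qed
  obtain L where L: "card L = card K" "top_set \<phi> L"
    using ex_top_set[of "card K" \<phi>] by (auto simp: card_mono)
  define V where "V = (\<Sum>j\<in>L. \<phi> j)"
  have kfF: "ky_fan_le (card K) (\<lambda>x. Re (cip x (rank1sum \<phi> \<omega> *v x))) V"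
    unfolding ky_fan_le_def V_def using ky_fan_maximum[OF F(2) \<phi> L(2)] L(1) by auto
  have ga: "0 \<le> g (a r)" for r using gpos a0 by simp
  define Z1 where "Z1 = colmat (\<lambda>r. of_real (sqrt (g (a r))) *s u r)"
  define Z2 where "Z2 = colmat (\<lambda>r. of_real (sqrt (g (a r))) *s w r)"
  define Z where "Z = colmat (\<lambda>r. of_real (sqrt (g (a r))) *s z r)"
  have "ky_fan_le (card K) (\<lambda>x. (norm (hadj Z1 *v x))\<^sup>2) V"
    using kfF unfolding Z1_def norm_hadj_colmat_sqrt[OF ga] Fu .
  from ky_fan_le_hadj[OF this] have k1: "ky_fan_le (card K) (\<lambda>c. (norm (Z1 *v c))\<^sup>2) V" by simp
  have "ky_fan_le (card K) (\<lambda>x. (norm (hadj Z2 *v x))\<^sup>2) V"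
    using kfF unfolding Z2_def norm_hadj_colmat_sqrt[OF ga] Fw .
  from ky_fan_le_hadj[OF this] have k2: "ky_fan_le (card K) (\<lambda>c. (norm (Z2 *v c))\<^sup>2) V" by simp
  \<comment> \<open>\<open>Z *v c\<close> stacks \<open>Z1 *v c\<close> and \<open>Z2 *v c\<close>,
    so on the Gram side the form is an exact mean, whereas the form of \<open>hadj Z\<close> has
    cross terms. The bound is therefore moved to the Gram side, averaged, and moved back.\<close>
  have Zc: "(norm (Z *v c))\<^sup>2 = ((norm (Z1 *v c))\<^sup>2 + (norm (Z2 *v c))\<^sup>2) / 2" for c
  proof -
    have "Z *v c = hjoin (Z1 *v c) (Z2 *v c)"
      by (simp add: Z_def Z1_def Z2_def colmat_mult z_def hjoin_sum_scale)
    then show ?thesis by (simp add: norm_hjoin)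
  qed
  have "ky_fan_le (card K) (\<lambda>c. (norm (Z *v c))\<^sup>2) V"
    unfolding ky_fan_le_def
  proof (intro allI impI)
    fix X :: "(complex^('n + 'n)) set"
    assume X: "finite X \<and> onf X (\<lambda>x. x) \<and> card X \<le> card K"
    have "(\<Sum>c\<in>X. (norm (Z *v c))\<^sup>2)
        = ((\<Sum>c\<in>X. (norm (Z1 *v c))\<^sup>2) + (\<Sum>c\<in>X. (norm (Z2 *v c))\<^sup>2)) / 2"
      by (simp add: Zc sum.distrib flip: sum_divide_distrib)
    moreover have "(\<Sum>c\<in>X. (norm (Z1 *v c))\<^sup>2) \<le> V" "(\<Sum>c\<in>X. (norm (Z2 *v c))\<^sup>2) \<le> V"
      using X k1 k2 unfolding ky_fan_le_def by blast+
    ultimately show "(\<Sum>c\<in>X. (norm (Z *v c))\<^sup>2) \<le> V" by simp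
  qed
  from ky_fan_le_hadj[OF this]
  have kfZ: "ky_fan_le (card K) (\<lambda>x. \<Sum>r\<in>UNIV. g (a r) * (cmod (cip (z r) x))\<^sup>2) V"
    unfolding Z_def norm_hadj_colmat_sqrt[OF ga] .

  have "psd (rank1sum a z)" by (rule psd_rank1sum) (rule a0)
  then obtain t :: "'n + 'n \<Rightarrow> complex^('n + 'n)" and \<mu>
    where t: "onf UNIV t" "rank1sum a z = rank1sum \<mu> t" "\<And>i. 0 \<le> \<mu> i"
    by (rule psd_spectral) (rule that)
  \<comment> \<open>Only nonzero singular values of \<open>A + B\<close> admit a normalised image
    \<open>y i\<close>; the others contribute \<open>g 0 = 0\<close>.\<close>
  define K0 where "K0 = {i\<in>K. s i \<noteq> 0}"
  define y where "y i = of_real (1 / s i) *s ((A + B) *v v i)" for i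
  define e where "e i = hjoin (y i) (v i)" for i
  have y: "onf K0 y"
    unfolding onf_def y_def cip_scale_left cip_scale_right cip_image_image[OF v(1,3)]
    by (auto simp: K0_def power2_eq_square)
  have vK: "onf K0 v" by (rule onf_subset[OF v(1)]) simp
  have e: "onf K0 e"
    using onfD[OF y] onfD[OF vK] by (auto simp: onf_def e_def cip_hjoin)
  \<comment> \<open>For \<open>p\<close> and \<open>q\<close> with the same coefficients the left
    side is the real part of \<open>cip p ((A + B) *v q)\<close>. This splits into a part for
    \<open>A\<close> and one for \<open>B\<close>, each bounded by
    \<open>singular_form_le\<close>.\<close>
  have ge: "(\<Sum>i\<in>K0. s i * (cmod (c i))\<^sup>2)
      \<le> Re (cip (\<Sum>i\<in>K0. c i *s e i) (rank1sum \<mu> t *v (\<Sum>i\<in>K0. c i *s e i)))" for c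
  proof -
    define p q where "p = (\<Sum>i\<in>K0. c i *s y i)" and "q = (\<Sum>i\<in>K0. c i *s v i)"
    have Sv: "(A + B) *v v i = of_real (s i) *s y i" if "i \<in> K0" for i
      using that by (simp add: y_def K0_def vec.scale_scale)
    have "(A + B) *v q = (\<Sum>i\<in>K0. c i *s ((A + B) *v v i))"
      by (simp add: q_def vec.linear_sum[OF matrix_vector_mul_linear_gen] vector_scalar_commute)
    also have "\<dots> = (\<Sum>i\<in>K0. (c i * of_real (s i)) *s y i)"
      by (intro sum.cong refl) (simp add: Sv vec.scale_scale)
    finally have "cip p ((A + B) *v q)
        = (\<Sum>i\<in>K0. cnj (c i) * cip (y i) (\<Sum>i\<in>K0. (c i * of_real (s i)) *s y i))"
      by (simp add: p_def cip_sum_left cip_scale_left)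
    also have "\<dots> = (\<Sum>i\<in>K0. cnj (c i) * (c i * of_real (s i)))"
      by (intro sum.cong refl) (simp add: cip_onf_sum[OF y])
    also have "\<dots> = of_real (\<Sum>i\<in>K0. s i * (cmod (c i))\<^sup>2)"
      by (simp add: of_real_cmod_square mult_ac)
    finally have "Re (cip p ((A + B) *v q)) = (\<Sum>i\<in>K0. s i * (cmod (c i))\<^sup>2)"
      by (simp only: Re_complex_of_real)
    then have "(\<Sum>i\<in>K0. s i * (cmod (c i))\<^sup>2) = Re (cip p (A *v q)) + Re (cip p (B *v q))"
      by (simp add: matrix_vector_mult_add_rdistrib cip_add_right)
    also have "\<dots> \<le> (\<Sum>i\<in>UNIV. aA i * (cmod (cip (hjoin (uA i) (wA i)) (hjoin p q)))\<^sup>2)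
        + (\<Sum>i\<in>UNIV. aB i * (cmod (cip (hjoin (uB i) (wB i)) (hjoin p q)))\<^sup>2)"
      by (intro add_mono singular_form_le sA sB)
    also have "\<dots> = Re (cip (hjoin p q) (rank1sum a z *v hjoin p q))"
      by (simp add: rank1sum_form sum_UNIV_Plus z_def a_def u_def w_def)
    also have "hjoin p q = (\<Sum>i\<in>K0. c i *s e i)"
      by (simp add: p_def q_def e_def hjoin_sum_scale)
    finally show ?thesis by (simp add: t(2))
  qed
  have "card {i\<in>K0. h \<le> s i} \<le> card {p. h \<le> \<mu> p}" for h
    by (rule eigenvalue_count_mono[OF t(1) e _ ge]) simp
  then obtain \<iota> where \<iota>: "inj_on \<iota> K0" "\<forall>i\<in>K0. s i \<le> \<mu> (\<iota> i)"
    using injection_from_counts[of K0 s \<mu>] by auto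
  have card_K0: "card (\<iota> ` K0) = card K0" "card K0 \<le> card K"
    using \<iota> by (auto simp: card_image K0_def intro: card_mono)
  obtain M where M: "card M = card K0" "top_set \<mu> M"
    using ex_top_set[of "card K0" \<mu>] card_K0 card_mono[of UNIV "\<iota> ` K0"] by auto
  \<comment> \<open>\<open>g\<close> is monotone, so a top set for \<open>\<mu>\<close> is one for
    its image; the eigenvalues hit by \<open>\<iota>\<close> can be replaced by the largest
    ones.\<close>
  have Mg: "top_set (\<lambda>p. g (\<mu> p)) M"
    using M(2) t(3) mono_onD[OF g(3)] by (auto simp: top_set_def)
  have "(\<Sum>i\<in>K. g (s i)) = (\<Sum>i\<in>K0. g (s i))"
    unfolding K0_def by (intro sum.mono_neutral_right) (auto simp: g)
  also have "\<dots> \<le> (\<Sum>i\<in>K0. g (\<mu> (\<iota> i)))"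
    using \<iota>(2) v(2) t(3) by (intro sum_mono mono_onD[OF g(3)]) auto
  also have "\<dots> = (\<Sum>p\<in>\<iota> ` K0. g (\<mu> p))" by (simp add: sum.reindex \<iota>)
  also have "\<dots> \<le> (\<Sum>p\<in>M. g (\<mu> p))"
    using gpos t(3) by (intro top_set_sum_ge_subset[OF Mg]) (simp_all add: card_K0 M)
  also have "\<dots> \<le> (\<Sum>p\<in>M. \<Sum>r\<in>UNIV. g (a r) * (cmod (cip (t p) (z r)))\<^sup>2)"
    by (rule rank1sum_ky_fan_concave[OF t(1,3) nz a0 t(2) g(1,2) M(2)])
  also have "\<dots> = (\<Sum>p\<in>M. \<Sum>r\<in>UNIV. g (a r) * (cmod (cip (z r) (t p)))\<^sup>2)"
    by (intro sum.cong refl) (metis norm_cip_commute)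
  also have "\<dots> \<le> V"
    using M(1) card_K0(2) by (intro ky_fan_le_onf[OF kfZ] onf_subset[OF t(1)]) auto
  finally show ?thesis using L(1) by (auto simp: V_def)
qed

subsection \<open>Weak majorization and symmetric norms\<close>

lemma ex_decreasing_enumeration:
  fixes h :: "'n::finite \<Rightarrow> real"
  obtains e where "bij_betw e {..<CARD('n)} UNIV"
    "\<And>i j. i \<le> j \<Longrightarrow> j < CARD('n) \<Longrightarrow> h (e j) \<le> h (e i)"
proof -
  obtain ys :: "'n list" where ys: "set ys = UNIV" "distinct ys"
    using finite_distinct_list[of "UNIV :: 'n set"] by auto
  define xs where "xs = sort_key (\<lambda>x. - h x) ys"
  have xs: "set xs = UNIV" "distinct xs" using ys by (auto simp: xs_def)
  then have len: "length xs = CARD('n)" by (metis distinct_card)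
  have "sorted (map (\<lambda>x. - h x) xs)" by (simp add: xs_def)
  then have "h (xs ! j) \<le> h (xs ! i)" if "i \<le> j" "j < CARD('n)" for i j
    using sorted_nth_mono[of "map (\<lambda>x. - h x) xs" i j] that len by simp
  moreover have "bij_betw ((!) xs) {..<CARD('n)} UNIV"
    using bij_betw_nth[OF xs(2), of "{..<CARD('n)}" UNIV] xs len by simp
  ultimately show ?thesis using that by blast
qed

text \<open>Summation by parts: the last weight times the partial sum of \<open>d\<close> stays
  below the weighted partial sum.\<close>

lemma abel_sum_nonneg:
  fixes W d :: "nat \<Rightarrow> real"
  assumes W: "\<And>j. 0 \<le> W j" "\<And>j. W (Suc j) \<le> W j"
    and D: "\<And>m. m \<le> n \<Longrightarrow> 0 \<le> (\<Sum>j<m. d j)"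
  shows "0 \<le> (\<Sum>j<n. W j * d j)"
proof -
  have "m \<le> n \<Longrightarrow> W m * (\<Sum>j<m. d j) \<le> (\<Sum>j<m. W j * d j)" for m
  proof (induction m)
    case (Suc m)
    have "W (Suc m) * (\<Sum>j<Suc m. d j) \<le> W m * (\<Sum>j<Suc m. d j)"
      using W D[OF Suc.prems] by (intro mult_right_mono)
    also have "\<dots> \<le> (\<Sum>j<Suc m. W j * d j)" using Suc by (simp add: distrib_left)
    finally show ?case .
  qed simp
  from order_trans[OF mult_nonneg_nonneg[OF W(1)[of n] D[OF order_refl]] this[OF order_refl]]
  show ?thesis .
qed

text \<open>List the weights and \<open>\<phi>\<close> in decreasing order and let
  \<open>\<pi>\<close> pair equal ranks. Majorization compares the partial sums along these lists,
  and Abel summation restores the weights.\<close>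

lemma weak_majorization_sum_le:
  fixes \<gamma> \<phi> w :: "'n::finite \<Rightarrow> real"
  assumes \<phi>: "\<And>i. 0 \<le> \<phi> i" and w: "\<And>i. 0 \<le> w i"
    and maj: "\<And>K. \<exists>L. card L = card K \<and> (\<Sum>i\<in>K. \<gamma> i) \<le> (\<Sum>i\<in>L. \<phi> i)"
  shows "\<exists>\<pi>. bij \<pi> \<and> (\<Sum>i\<in>UNIV. w i * \<gamma> i) \<le> (\<Sum>i\<in>UNIV. w i * \<phi> (\<pi> i))"
proof -
  let ?n = "CARD('n)"
  obtain e where e: "bij_betw e {..<?n} (UNIV :: 'n set)"
    "\<And>i j. i \<le> j \<Longrightarrow> j < ?n \<Longrightarrow> w (e j) \<le> w (e i)"
    using ex_decreasing_enumeration[of w] by blast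
  obtain e' where e': "bij_betw e' {..<?n} (UNIV :: 'n set)"
    "\<And>i j. i \<le> j \<Longrightarrow> j < ?n \<Longrightarrow> \<phi> (e' j) \<le> \<phi> (e' i)"
    using ex_decreasing_enumeration[of \<phi>] by blast
  \<comment> \<open>The value 0 beyond the dimension keeps \<open>W\<close> nonnegative and
    decreasing on all of \<open>nat\<close>.\<close>
  define W where "W j = (if j < ?n then w (e j) else 0)" for j
  have "0 \<le> (\<Sum>j<?n. W j * (\<phi> (e' j) - \<gamma> (e j)))"
  proof (rule abel_sum_nonneg)
    show "0 \<le> W j" for j using w by (simp add: W_def)
    show "W (Suc j) \<le> W j" for j using w e(2)[of j "Suc j"] by (simp add: W_def)
    fix m assume m: "m \<le> ?n"
    have inj: "inj_on e {..<m}" "inj_on e' {..<m}"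
      using e(1) e'(1) m by (auto simp: bij_betw_def intro: inj_on_subset)
    obtain L where L: "card L = card (e ` {..<m})" "(\<Sum>i\<in>e ` {..<m}. \<gamma> i) \<le> (\<Sum>i\<in>L. \<phi> i)"
      using maj by blast
    have top: "top_set \<phi> (e' ` {..<m})"
      unfolding top_set_def
    proof (intro ballI)
      fix i j assume i: "i \<in> e' ` {..<m}" and j: "j \<in> - e' ` {..<m}"
      obtain k where k: "k < m" "i = e' k" using i by auto
      obtain l where l: "l < ?n" "j = e' l" using e'(1) by (metis UNIV_I bij_betw_imp_surj_on imageE lessThan_iff)
      have "m \<le> l" using j l by (metis ComplD imageI lessThan_iff not_le)
      then show "\<phi> j \<le> \<phi> i" using e'(2)[of k l] k l by simp
    qed
    have "(\<Sum>i\<in>L. \<phi> i) \<le> (\<Sum>i\<in>e' ` {..<m}. \<phi> i)"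
      by (rule top_set_sum_ge_subset[OF top \<phi>]) (simp add: L(1) card_image inj)
    then have "(\<Sum>j<m. \<gamma> (e j)) \<le> (\<Sum>j<m. \<phi> (e' j))"
      using L(2) by (simp add: sum.reindex inj)
    then show "0 \<le> (\<Sum>j<m. \<phi> (e' j) - \<gamma> (e j))" by (simp add: sum_subtractf)
  qed
  then have le: "(\<Sum>j<?n. w (e j) * \<gamma> (e j)) \<le> (\<Sum>j<?n. w (e j) * \<phi> (e' j))"
    by (simp add: W_def right_diff_distrib sum_subtractf)
  define \<pi> where "\<pi> = e' \<circ> inv_into {..<?n} e"
  have "bij \<pi>" unfolding \<pi>_def by (rule bij_betw_trans[OF bij_betw_inv_into[OF e(1)] e'(1)])
  moreover have "(\<Sum>i\<in>UNIV. w i * \<gamma> i) = (\<Sum>j<?n. w (e j) * \<gamma> (e j))"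
    by (rule sum.reindex_bij_betw[OF e(1), symmetric])
  moreover have "(\<Sum>i\<in>UNIV. w i * \<phi> (\<pi> i)) = (\<Sum>j<?n. w (e j) * \<phi> (\<pi> (e j)))"
    by (rule sum.reindex_bij_betw[OF e(1), symmetric])
  moreover have "\<pi> (e j) = e' j" if "j < ?n" for j
    using that e(1) by (simp add: \<pi>_def bij_betw_def)
  ultimately show ?thesis using le by (intro exI[of _ \<pi>]) simp
qed

text \<open>The orbit of \<open>\<phi>\<close> under permutations and sign changes of coordinates;
  on diagonal matrices these do not change a symmetric norm.\<close>

definition signed_perms :: "('n::finite \<Rightarrow> real) \<Rightarrow> (real^'n) set" where
  "signed_perms \<phi> = (\<lambda>(S, \<pi>). \<chi> i. (if i \<in> S then - 1 else 1) * \<phi> (\<pi> i)) ` (UNIV \<times> {\<pi>. bij \<pi>})"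

text \<open>Otherwise a hyperplane separates the two. The orbit point with signs opposite to those
  of its normal \<open>a\<close>, paired by rank with the absolute values of \<open>a\<close>, lies
  on the wrong side.\<close>

lemma weak_majorization_convex_hull:
  fixes \<gamma> \<phi> :: "'n::finite \<Rightarrow> real"
  assumes \<gamma>: "\<And>i. 0 \<le> \<gamma> i" and \<phi>: "\<And>i. 0 \<le> \<phi> i"
    and maj: "\<And>K. \<exists>L. card L = card K \<and> (\<Sum>i\<in>K. \<gamma> i) \<le> (\<Sum>i\<in>L. \<phi> i)"
  shows "(\<chi> i. \<gamma> i) \<in> convex hull signed_perms \<phi>"
proof (rule ccontr)
  assume "\<not> ?thesis"
  moreover have "closed (convex hull signed_perms \<phi>)"
    by (intro compact_imp_closed finite_imp_compact_convex_hull) (simp add: signed_perms_def)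
  ultimately obtain a b where ab: "inner a (\<chi> i. \<gamma> i) < b"
    "\<And>x. x \<in> convex hull signed_perms \<phi> \<Longrightarrow> b < inner a x"
    using separating_hyperplane_closed_point[OF convex_convex_hull, of "signed_perms \<phi>"] by blast
  obtain \<pi> where \<pi>: "bij \<pi>"
    "(\<Sum>i\<in>UNIV. \<bar>a $ i\<bar> * \<gamma> i) \<le> (\<Sum>i\<in>UNIV. \<bar>a $ i\<bar> * \<phi> (\<pi> i))"
    using weak_majorization_sum_le[OF \<phi> _ maj, of "\<lambda>i. \<bar>a $ i\<bar>"] by auto
  define x :: "real^'n" where "x = (\<chi> i. (if i \<in> {i. 0 \<le> a $ i} then - 1 else 1) * \<phi> (\<pi> i))"
  have "x \<in> signed_perms \<phi>"
    unfolding signed_perms_def x_def using \<pi>(1) by (intro image_eqI[of _ _ "({i. 0 \<le> a $ i}, \<pi>)"]) auto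
  then have "b < inner a x" by (intro ab(2) hull_inc)
  moreover have "inner a x = - (\<Sum>i\<in>UNIV. \<bar>a $ i\<bar> * \<phi> (\<pi> i))"
    unfolding inner_vec_def sum_negf[symmetric] by (intro sum.cong) (auto simp: x_def)
  moreover have "- (\<Sum>i\<in>UNIV. \<bar>a $ i\<bar> * \<gamma> i) \<le> inner a (\<chi> i. \<gamma> i)"
    unfolding inner_vec_def sum_negf[symmetric]
  proof (intro sum_mono)
    fix i
    show "- (\<bar>a $ i\<bar> * \<gamma> i) \<le> inner (a $ i) ((\<chi> i. \<gamma> i) $ i)"
      using mult_right_mono[OF _ \<gamma>[of i], of "- \<bar>a $ i\<bar>" "a $ i"] by simp
  qed
  ultimately show False using \<pi>(2) ab(1) by linarith
qed

section \<open>Symmetric norms as functions of the eigenvalues\<close>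

lemma symmetric_norm_unitary:
  "symmetric_norm N \<Longrightarrow> unitary U \<Longrightarrow> unitary V \<Longrightarrow> N (U ** X ** V) = N X"
  unfolding symmetric_norm_def by blast

lemma symmetric_norm_add_smat:
  "symmetric_norm N \<Longrightarrow> N (smat c X + smat d Y) \<le> cmod c * N X + cmod d * N Y"
  unfolding symmetric_norm_def by metis

lemma symmetric_norm_rank1sum:
  fixes t :: "'n::finite \<Rightarrow> complex^'n"
  assumes N: "symmetric_norm N" and t: "onf UNIV t"
  shows "N (rank1sum d t) = N (diag_mat (\<lambda>i. complex_of_real (d i)))"
proof -
  obtain U where U: "unitary U" "\<And>i. column i U = t i" using unitary_of_onf[OF t] by blast
  have "rank1sum d t = U ** diag_mat (\<lambda>i. complex_of_real (d i)) ** adj U"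
    by (simp add: unitary_diag_rank1sum U)
  moreover have "unitary (adj U)" using U(1) by (simp add: unitary_def)
  ultimately show ?thesis using symmetric_norm_unitary[OF N U(1)] by simp
qed

lemma symmetric_norm_signed_perms:
  fixes \<phi> :: "'n::finite \<Rightarrow> real"
  assumes N: "symmetric_norm N" and x: "x \<in> signed_perms \<phi>"
  shows "N (diag_mat (\<lambda>i. complex_of_real (x $ i))) = N (diag_mat (\<lambda>i. complex_of_real (\<phi> i)))"
proof -
  obtain S \<pi> where \<pi>: "bij \<pi>" and x: "x = (\<chi> i. (if i \<in> S then - 1 else 1) * \<phi> (\<pi> i))"
    using x by (auto simp: signed_perms_def)
  define D :: "'n cmat" where "D = diag_mat (\<lambda>i. if i \<in> S then - 1 else 1)"
  have diag_mult: "diag_mat c ** diag_mat d = diag_mat (\<lambda>i. c i * d i)" for c d :: "'n \<Rightarrow> complex"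
  proof -
    have "(\<Sum>k\<in>UNIV. (if i = k then c i else 0) * (if k = j then d k else 0))
        = (if i = j then c i * d i else 0)" for i j
    proof -
      have "(\<Sum>k\<in>UNIV. (if i = k then c i else 0) * (if k = j then d k else 0))
          = (\<Sum>k\<in>UNIV. if i = k then c i * (if k = j then d k else 0) else 0)"
        by (intro sum.cong) auto
      then show ?thesis by simp
    qed
    then show ?thesis by (simp add: diag_mat_def matrix_matrix_mult_def vec_eq_iff)
  qed
  have "adj D = D" by (simp add: D_def adj_def diag_mat_def vec_eq_iff)
  moreover have "D ** D = mat 1"
    by (simp add: D_def diag_mult) (simp add: diag_mat_def mat_def vec_eq_iff)
  ultimately have D: "unitary D" by (simp add: unitary_def)
  have I: "unitary (mat 1 :: 'n cmat)"
  proof -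
    have "adj (mat 1 :: 'n cmat) = mat 1" by (simp add: adj_def mat_def vec_eq_iff)
    then show ?thesis by (simp add: unitary_def)
  qed
  have "diag_mat (\<lambda>i. complex_of_real (x $ i)) = D ** diag_mat (\<lambda>i. complex_of_real (\<phi> (\<pi> i))) ** mat 1"
    by (simp add: D_def diag_mult) (simp add: x diag_mat_def vec_eq_iff)
  then have 1: "N (diag_mat (\<lambda>i. complex_of_real (x $ i))) = N (diag_mat (\<lambda>i. complex_of_real (\<phi> (\<pi> i))))"
    using symmetric_norm_unitary[OF N D I] by simp
  define ax where "ax i = (axis i 1 :: complex^'n)" for i
  have ax: "onf UNIV (\<lambda>i. ax (\<rho> i))" if "inj \<rho>" for \<rho> :: "'n \<Rightarrow> 'n"
  proof -
    have "cip (ax i) (ax j) = (\<Sum>k\<in>UNIV. if k = i then (if i = j then 1 else 0) else 0)" for i j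
      unfolding cip_def by (intro sum.cong) (auto simp: ax_def axis_def)
    then show ?thesis using that by (simp add: onf_def inj_eq)
  qed
  \<comment> \<open>Permuting the diagonal amounts to attaching the same values to a permuted
    standard basis, which is again orthonormal.\<close>
  have reindex: "rank1sum (\<lambda>i. \<phi> (\<pi> i)) ax = rank1sum \<phi> (\<lambda>i. ax (inv \<pi> i))"
  proof -
    have "(\<Sum>r\<in>UNIV. h (\<pi> r) r) = (\<Sum>r\<in>UNIV. h r (inv \<pi> r))" for h :: "'n \<Rightarrow> 'n \<Rightarrow> complex"
      using sum.reindex_bij_betw[OF \<pi>, of "\<lambda>r. h r (inv \<pi> r)"] \<pi> by (simp add: bij_is_inj)
    from this[of "\<lambda>p r. of_real (\<phi> p) * ax r $ i * cnj (ax r $ j)" for i j]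
    show ?thesis by (simp add: rank1sum_def)
  qed
  have o1: "onf UNIV ax" using ax[of "\<lambda>i. i"] by simp
  have o2: "onf UNIV (\<lambda>i. ax (inv \<pi> i))"
    using \<pi> by (intro ax) (simp add: bij_imp_bij_inv bij_is_inj)
  show ?thesis
    using 1 symmetric_norm_rank1sum[OF N o1, of "\<lambda>i. \<phi> (\<pi> i)"]
      symmetric_norm_rank1sum[OF N o2, of \<phi>] reindex by simp
qed

text \<open>The norm of a diagonal matrix is convex in its diagonal and constant on
  \<open>signed_perms \<phi>\<close>, so that constant bounds it on the convex hull, which contains
  \<open>\<gamma>\<close>.\<close>

lemma ky_fan_dominance:
  fixes t u :: "'n::finite \<Rightarrow> complex^'n"
  assumes N: "symmetric_norm N" and t: "onf UNIV t" and u: "onf UNIV u"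
    and \<gamma>: "\<And>i. 0 \<le> \<gamma> i" and \<phi>: "\<And>i. 0 \<le> \<phi> i"
    and maj: "\<And>K. \<exists>L. card L = card K \<and> (\<Sum>i\<in>K. \<gamma> i) \<le> (\<Sum>i\<in>L. \<phi> i)"
  shows "N (rank1sum \<gamma> t) \<le> N (rank1sum \<phi> u)"
proof -
  define M where "M x = N (diag_mat (\<lambda>i. complex_of_real (x $ i)))" for x :: "real^'n"
  have "convex_on UNIV M"
  proof (rule convex_onI)
    fix s :: real and x y :: "real^'n"
    assume s: "0 < s" "s < 1"
    have "diag_mat (\<lambda>i. complex_of_real (((1 - s) *\<^sub>R x + s *\<^sub>R y) $ i))
      = smat (of_real (1 - s)) (diag_mat (\<lambda>i. complex_of_real (x $ i)))
        + smat (of_real s) (diag_mat (\<lambda>i. complex_of_real (y $ i)))"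
      by (simp add: diag_mat_def smat_def vec_eq_iff)
    then have "M ((1 - s) *\<^sub>R x + s *\<^sub>R y) \<le> cmod (of_real (1 - s)) * M x + cmod (of_real s) * M y"
      unfolding M_def by (simp only: symmetric_norm_add_smat[OF N])
    then show "M ((1 - s) *\<^sub>R x + s *\<^sub>R y) \<le> (1 - s) * M x + s * M y"
      using s unfolding norm_of_real by simp
  qed simp
  then have "convex_on (convex hull signed_perms \<phi>) M"
    by (rule convex_on_subset) simp_all
  moreover have "\<forall>x\<in>signed_perms \<phi>. M x \<le> N (rank1sum \<phi> u)"
    by (simp add: M_def symmetric_norm_signed_perms[OF N] symmetric_norm_rank1sum[OF N u])
  ultimately have "M (\<chi> i. \<gamma> i) \<le> N (rank1sum \<phi> u)"
    using convex_on_convex_hull_bound weak_majorization_convex_hull[OF \<gamma> \<phi> maj] by blast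
  then show ?thesis by (simp add: M_def symmetric_norm_rank1sum[OF N t])
qed

text \<open>If \<open>f\<close> dropped between \<open>x\<close> and \<open>y\<close>, concavity
  would force it below 0 further to the right.\<close>

lemma concave_nonneg_mono:
  fixes f :: "real \<Rightarrow> real"
  assumes "concave_on {0..} f" "\<forall>x\<ge>0. 0 \<le> f x"
  shows "mono_on {0..} f"
proof (rule mono_onI)
  fix x y :: real
  assume xy: "x \<in> {0..}" "y \<in> {0..}" "x \<le> y"
  show "f x \<le> f y"
  proof (rule ccontr)
    assume "\<not> f x \<le> f y"
    then have lt: "f y < f x" "x < y" using xy by (auto simp: less_le)
    \<comment> \<open>\<open>z\<close> is placed so that \<open>y\<close> has weight
      \<open>c\<close> on \<open>z\<close> and \<open>1 - c\<close> on \<open>x\<close>. The summand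
      1 keeps \<open>c\<close> below 1 and makes \<open>(1 - c) * f x\<close> exceed
      \<open>f y\<close>.\<close>
    define c where "c = (f x - f y) / (f x + 1)"
    have fxy: "0 \<le> f x" "0 \<le> f y" using assms(2) xy by auto
    have l: "0 < c" "c < 1"
      unfolding c_def using lt fxy by (simp_all add: divide_less_eq_1)
    define z where "z = x + (y - x) / c"
    have z: "0 \<le> z" using lt l xy by (simp add: z_def)
    have "c * z = c * x + (y - x)" using l by (simp add: z_def distrib_left)
    then have "(1 - c) *\<^sub>R x + c *\<^sub>R z = y" by (simp add: left_diff_distrib)
    then have "(1 - c) * f x + c * f z \<le> f y"
      using concave_onD[OF assms(1), of c x z] l z xy by simp
    moreover have "0 \<le> c * f z" using assms(2) z l by simp
    ultimately have "f x - f y \<le> c * f x" by (simp add: algebra_simps)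
    also have "\<dots> = (f x - f y) * (f x / (f x + 1))" by (simp add: c_def)
    also have "\<dots> < (f x - f y) * 1"
      using lt fxy by (intro mult_strict_left_mono) auto
    finally show False by simp
  qed
qed

section \<open>Splitting off the value at zero\<close>

lemma mat_fun_abs_shift:
  fixes X :: "'n::finite cmat"
  shows "mat_fun (\<lambda>x. g x + c) (mat_abs X) *v y = mat_fun g (mat_abs X) *v y + of_real c *s y"
proof -
  obtain t :: "'n \<Rightarrow> complex^'n" and a where t: "onf UNIV t" "mat_abs X = rank1sum a t" "\<And>i. 0 \<le> a i"
    "adj X ** X = rank1sum (\<lambda>i. (a i)\<^sup>2) t"
    by (rule mat_abs_spectral[of X]) (rule that)
  have "rank1sum (\<lambda>i. g (a i) + c) t *v y
      = rank1sum (\<lambda>i. g (a i)) t *v y + of_real c *s (\<Sum>i\<in>UNIV. cip (t i) y *s t i)"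
    by (simp add: rank1sum_mult distrib_right vec.scale_left_distrib sum.distrib vec.scale_sum_right)
  then show ?thesis by (simp add: t(2) mat_fun_rank1sum[OF t(1,3)] onf_expand[OF t(1)])
qed

lemma psd_mat_fun_abs:
  fixes X :: "'n::finite cmat"
  assumes "\<And>x. 0 \<le> x \<Longrightarrow> 0 \<le> g x"
  shows "psd (mat_fun g (mat_abs X))"
proof -
  obtain t :: "'n \<Rightarrow> complex^'n" and a where t: "onf UNIV t" "mat_abs X = rank1sum a t" "\<And>i. 0 \<le> a i"
    "adj X ** X = rank1sum (\<lambda>i. (a i)\<^sup>2) t"
    by (rule mat_abs_spectral[of X]) (rule that)
  show ?thesis unfolding t(2) mat_fun_rank1sum[OF t(1,3)]
    by (intro psd_rank1sum assms t)
qed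

lemma psd_add: "psd H \<Longrightarrow> psd G \<Longrightarrow> psd (H + G)"
  by (simp add: psd_iff matrix_vector_mult_add_rdistrib cip_add_right)
     (simp add: adj_def vec_eq_iff)

theorem theorem2p1:
  fixes A B :: "complex ^ 'n::finite ^ 'n" and f :: "real \<Rightarrow> real"
    and N :: "complex ^ 'n ^ 'n \<Rightarrow> real"
  assumes "normal_mat A" and "normal_mat B"
    and "\<forall>x\<ge>0. 0 \<le> f x" and "concave_on {0..} f"
    and "symmetric_norm N"
  shows "N (mat_fun f (mat_abs (A + B))) \<le> N (mat_fun f (mat_abs A) + mat_fun f (mat_abs B))"
proof -
  \<comment> \<open>\<open>f\<close> of an absolute value is \<open>g\<close> of it plus
    \<open>f 0\<close> times the identity, and \<open>g\<close> meets the requirement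
    \<open>g 0 = 0\<close> of the Ky Fan estimate.\<close>
  define g where "g x = f x - f 0" for x
  have f_eq: "f = (\<lambda>x. g x + f 0)" by (simp add: g_def)
  have shift: "mat_fun f (mat_abs X) *v y = mat_fun g (mat_abs X) *v y + of_real (f 0) *s y"
    for X :: "'n cmat" and y
    using mat_fun_abs_shift[of g "f 0" X y] unfolding f_eq[symmetric] .
  have f0: "0 \<le> f 0" using assms(3) by simp
  have fmono: "mono_on {0..} f" by (rule concave_nonneg_mono[OF assms(4,3)])
  have g: "concave_on {0..} g" "g 0 = 0" "mono_on {0..} g"
  proof -
    show "concave_on {0..} g"
      using concave_on_diff[OF assms(4), of "\<lambda>_. f 0"] by (simp add: g_def[abs_def] convex_on_const)
    show "mono_on {0..} g" using fmono by (simp add: g_def[abs_def] mono_on_def)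
  qed (simp add: g_def)
  have gpos: "0 \<le> g x" if "0 \<le> x" for x
    using mono_onD[OF g(3), of 0 x] that g(2) by simp
  obtain v :: "'n \<Rightarrow> complex^'n" and s where v: "onf UNIV v" "mat_abs (A + B) = rank1sum s v"
    "\<And>i. 0 \<le> s i" "adj (A + B) ** (A + B) = rank1sum (\<lambda>i. (s i)\<^sup>2) v"
    by (rule mat_abs_spectral[of "A + B"]) (rule that)
  have "psd (mat_fun g (mat_abs A) + mat_fun g (mat_abs B))"
    by (intro psd_add psd_mat_fun_abs gpos)
  then obtain \<omega> :: "'n \<Rightarrow> complex^'n" and \<phi> where \<omega>: "onf UNIV \<omega>"
    "mat_fun g (mat_abs A) + mat_fun g (mat_abs B) = rank1sum \<phi> \<omega>" "\<And>i. 0 \<le> \<phi> i"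
    by (rule psd_spectral) (rule that)
  have "mat_fun f (mat_abs A) + mat_fun f (mat_abs B) = rank1sum (\<lambda>j. \<phi> j + 2 * f 0) \<omega>"
  proof (rule rank1sumI[OF \<omega>(1)])
    fix j
    have "(mat_fun f (mat_abs A) + mat_fun f (mat_abs B)) *v \<omega> j
        = (mat_fun g (mat_abs A) + mat_fun g (mat_abs B)) *v \<omega> j + of_real (2 * f 0) *s \<omega> j"
      by (simp add: matrix_vector_mult_add_rdistrib shift vec_eq_iff algebra_simps)
    then show "(mat_fun f (mat_abs A) + mat_fun f (mat_abs B)) *v \<omega> j
        = of_real (\<phi> j + 2 * f 0) *s \<omega> j"
      by (simp add: \<omega>(2) rank1sum_eigen[OF \<omega>(1)] vec.scale_left_distrib)
  qed
  moreover have "mat_fun f (mat_abs (A + B)) = rank1sum (\<lambda>i. f (s i)) v"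
    unfolding v(2) by (rule mat_fun_rank1sum[OF v(1,3)])
  moreover have "N (rank1sum (\<lambda>i. f (s i)) v) \<le> N (rank1sum (\<lambda>j. \<phi> j + 2 * f 0) \<omega>)"
  proof (rule ky_fan_dominance[OF assms(5) v(1) \<omega>(1)])
    show "0 \<le> f (s i)" for i using assms(3) v(3) by simp
    show "0 \<le> \<phi> j + 2 * f 0" for j using \<omega>(3) f0 by simp
    fix K :: "'n set"
    obtain L where L: "card L = card K" "(\<Sum>i\<in>K. g (s i)) \<le> (\<Sum>j\<in>L. \<phi> j)"
      using ky_fan_subadditive[OF assms(1,2) g v(1,3,4) \<omega>(2,1)] by blast
    have "(\<Sum>i\<in>K. f (s i)) = (\<Sum>i\<in>K. g (s i)) + card K * f 0"
      by (simp add: g_def sum_subtractf)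
    \<comment> \<open>Each index carries one copy of \<open>f 0\<close> on the left and two on the
      right, which is harmless as \<open>f 0\<close> is nonnegative.\<close>
    also have "\<dots> \<le> (\<Sum>j\<in>L. \<phi> j) + card L * (2 * f 0)"
      using L f0 by (intro add_mono) (auto intro!: mult_left_mono)
    also have "\<dots> = (\<Sum>j\<in>L. \<phi> j + 2 * f 0)" by (simp add: sum.distrib)
    finally show "\<exists>L. card L = card K \<and> (\<Sum>i\<in>K. f (s i)) \<le> (\<Sum>j\<in>L. \<phi> j + 2 * f 0)"
      using L(1) by blast
  qed
  ultimately show ?thesis by simp
qed

end
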